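(* Let $G=(V,E)$ be a directed graph with $|V|=n$, accessed through the oracle $\mathcal{O}_G$. Then there exists a (recursive) quantum algorithm that decides directed $st$-connectivity (\textsc{dstcon}) on $G$ with bounded error in time $\widetilde{O}\big((\sqrt{2n})^{\log n}\big)=2^{\frac12\log^2 n+O(\log n)}$ and space $O(\log^2 n)$.
   Context: \textsc{dstcon}: given access to a directed graph $G=(V,E)$ via the oracle $\mathcal{O}_G$, and two vertices $s,t\in V$, decide whether there is a directed path from $s$ to $t$ in $G$. The oracle is the adjacency-matrix oracle, at unit cost per query: for $u,v\in V$, $\mathcal{O}_G:|u\rangle|v\rangle|0\rangle\mapsto|u\rangle|v\rangle|1\rangle$ if $(u,v)\in E$, and $|u\rangle|v\rangle|0\rangle$ otherwise. Without loss of generality $(u,u)\in E$ for all $u\in V$. Logarithms are base 2. Model of computation. A quantum algorithm is a sequence of unit-cost unitaries (elementary gates or oracle queries) on a common finite-dimensional space; time is the number of unitaries and space is the number of qubits. For a family of subroutines $\{(U^i_1,\dots,U^i_{T_i})\}_i$ with $T_i\le T_{\max}$, the operator $\sum_i|i\rangle\langle i|\otimes\sum_{t=1}^{T_{\max}}|t\rangle\langle t|\otimes U^i_t$ can be applied at unit cost. Bounded error: correct with probability at least $2/3$. $\widetilde O$ suppresses polylogarithmic factors of its argument. *)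

theory Defs
  imports
    "Jordan_Normal_Form.Schur_Decomposition"
    "Graph_Theory.Graph_Theory"
    "HOL-Library.Landau_Symbols"
    "HOL-Library.Log_Nat"
begin

text \<open>
  The state space of \<open>m\<close> qubits is the space of complex vectors of dimension \<open>2 ^ m\<close>. The computational
  basis states are numbered by \<open>i < 2 ^ m\<close>, and qubit \<open>q\<close> of basis state \<open>i\<close> is \<open>bit i q\<close>. A register is
  a list of distinct qubits, least significant qubit first.
\<close>

definition reg :: "nat list \<Rightarrow> nat \<Rightarrow> nat" where
  "reg qs i = horner_sum of_bool 2 (map (bit i) qs)"

text \<open>
  Unit-cost unitaries. \<open>Gate qs U\<close> applies \<open>U\<close> to the register \<open>qs\<close>. \<open>Query us vs a\<close> is the adjacency
  matrix oracle on the registers \<open>us\<close>, \<open>vs\<close> with answer qubit \<open>a\<close>. \<open>Select is ts F\<close> is the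
  operator \<open>\<Sum>\<^sub>i |i><i| \<otimes> \<Sum>\<^sub>t |t><t| \<otimes> U\<^sup>i\<^sub>t\<close> with \<open>i\<close> in register \<open>is\<close> and \<open>t\<close> in register \<open>ts\<close>, where
  \<open>F ! i\<close> is the subroutine \<open>[U\<^sup>i\<^sub>1, \<dots>, U\<^sup>i\<^sub>T\<^sub>i]\<close>.
\<close>

datatype instr =
    Gate "nat list" "complex mat"
  | Query "nat list" "nat list" nat
  | Select "nat list" "nat list" "instr list list"

definition unitary_mat :: "complex mat \<Rightarrow> bool" where
  "unitary_mat U \<longleftrightarrow> square_mat U \<and> mat_adjoint U * U = 1\<^sub>m (dim_row U)"

text \<open>
  \<open>unit_cost k Q I\<close>: \<open>I\<close> is a unit-cost unitary acting on qubits from \<open>Q\<close> only, where vertices are stored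
  in \<open>k\<close> qubits. Elementary gates are the one- and two-qubit unitaries. A subroutine used by \<open>Select\<close>
  acts outside the two control registers, and its step numbers have to fit into the register \<open>ts\<close>,
  so that \<open>T\<^sub>i \<le> T\<^sub>m\<^sub>a\<^sub>x = 2 ^ length ts - 1\<close>.
\<close>

inductive unit_cost :: "nat \<Rightarrow> nat set \<Rightarrow> instr \<Rightarrow> bool" for k where
  Gate: "unit_cost k Q (Gate qs U)"
  if "distinct qs" "set qs \<subseteq> Q" "length qs \<in> {1, 2}"
    "U \<in> carrier_mat (2 ^ length qs) (2 ^ length qs)" "unitary_mat U"
| Query: "unit_cost k Q (Query us vs a)"
  if "distinct (us @ vs @ [a])" "set (us @ vs @ [a]) \<subseteq> Q" "length us = k" "length vs = k"
| Select: "unit_cost k Q (Select is ts F)"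
  if "distinct (is @ ts)" "set (is @ ts) \<subseteq> Q" "length F \<le> 2 ^ length is"
    "\<And>S. S \<in> set F \<Longrightarrow> length S < 2 ^ length ts"
    "\<And>S I. S \<in> set F \<Longrightarrow> I \<in> set S \<Longrightarrow> unit_cost k (Q - set (is @ ts)) I"

definition gate_mat :: "nat \<Rightarrow> nat list \<Rightarrow> complex mat \<Rightarrow> complex mat" where
  "gate_mat m qs U = mat (2 ^ m) (2 ^ m) (\<lambda>(r, c).
     if \<forall>q<m. q \<notin> set qs \<longrightarrow> bit r q = bit c q then U $$ (reg qs r, reg qs c) else 0)"

text \<open>
  The answer qubit is flipped if the queried pair is an arc; this extends the prescription for answer
  qubit 0 to a unitary. Register values that are not vertices are never arcs.
\<close>

definition query_mat ::
    "nat \<Rightarrow> nat pair_pre_digraph \<Rightarrow> nat list \<Rightarrow> nat list \<Rightarrow> nat \<Rightarrow> complex mat" where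
  "query_mat m G us vs a = mat (2 ^ m) (2 ^ m) (\<lambda>(r, c).
     if r = (if (reg us c, reg vs c) \<in> parcs G then flip_bit a c else c) then 1 else 0)"

text \<open>
  Since the block for \<open>(i, t)\<close> does not touch the control registers, the operator is obtained by taking
  each column from the block selected by that column. Where there is no \<open>U\<^sup>i\<^sub>t\<close>, the operator is the
  identity. Steps \<open>t\<close> are counted from 1, list positions from 0.
\<close>

definition select_mat ::
    "nat \<Rightarrow> nat list \<Rightarrow> nat list \<Rightarrow> complex mat list list \<Rightarrow> complex mat" where
  "select_mat m is ts F = mat (2 ^ m) (2 ^ m) (\<lambda>(r, c).
     let i = reg is c; t = reg ts c in
     if reg is r = i \<and> reg ts r = t
     then (if i < length F \<and> 1 \<le> t \<and> t \<le> length (F ! i)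
           then F ! i ! (t - 1) else 1\<^sub>m (2 ^ m)) $$ (r, c)
     else 0)"

primrec instr_mat :: "nat \<Rightarrow> nat pair_pre_digraph \<Rightarrow> instr \<Rightarrow> complex mat" where
  "instr_mat m G (Gate qs U) = gate_mat m qs U"
| "instr_mat m G (Query us vs a) = query_mat m G us vs a"
| "instr_mat m G (Select is ts F) = select_mat m is ts (map (map (instr_mat m G)) F)"

record qalg =
  qubits :: nat
  steps :: "instr list"
  out_qubit :: nat

abbreviation qtime :: "qalg \<Rightarrow> nat" where
  "qtime A \<equiv> length (steps A)"

text \<open>The vertices are \<open>0, \<dots>, n - 1\<close>, stored in binary. The instructions do not depend on the graph.\<close>

definition st_algorithm :: "nat \<Rightarrow> qalg \<Rightarrow> bool" where
  "st_algorithm n A \<longleftrightarrow>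
     2 * ceillog2 n \<le> qubits A \<and> out_qubit A < qubits A \<and>
     (\<forall>I \<in> set (steps A). unit_cost (ceillog2 n) {..<qubits A} I)"

text \<open>
  On input \<open>s\<close>, \<open>t\<close> the initial state is \<open>|s>|t>|0>\<close>, with \<open>s\<close> in the lowest \<open>ceillog2 n\<close> qubits and
  \<open>t\<close> in the next ones.
\<close>

definition final_state ::
    "nat \<Rightarrow> qalg \<Rightarrow> nat pair_pre_digraph \<Rightarrow> nat \<Rightarrow> nat \<Rightarrow> complex vec" where
  "final_state n A G s t =
     fold (\<lambda>I v. instr_mat (qubits A) G I *\<^sub>v v) (steps A)
       (unit_vec (2 ^ qubits A) (s + 2 ^ ceillog2 n * t))"

definition prob_output ::
    "nat \<Rightarrow> qalg \<Rightarrow> nat pair_pre_digraph \<Rightarrow> nat \<Rightarrow> nat \<Rightarrow> bool \<Rightarrow> real" where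
  "prob_output n A G s t b =
     (\<Sum>i | i < 2 ^ qubits A \<and> bit i (out_qubit A) = b. (cmod (final_state n A G s t $ i))\<^sup>2)"

definition dstcon :: "nat pair_pre_digraph \<Rightarrow> nat \<Rightarrow> nat \<Rightarrow> bool" where
  "dstcon G s t \<longleftrightarrow> (\<exists>p. pre_digraph.apath (with_proj G) s p t)"

definition decides_dstcon :: "nat \<Rightarrow> qalg \<Rightarrow> nat pair_pre_digraph \<Rightarrow> bool" where
  "decides_dstcon n A G \<longleftrightarrow>
     (\<forall>s \<in> pverts G. \<forall>t \<in> pverts G. prob_output n A G s t (dstcon G s t) \<ge> 2 / 3)"

definition soft_O :: "(nat \<Rightarrow> real) \<Rightarrow> (nat \<Rightarrow> real) set" where
  "soft_O g = {f. \<exists>j::nat. f \<in> O(\<lambda>n. g n * log 2 (g n) ^ j)}"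

end

theory Submission
  imports Defs
begin

text \<open>
  No amplitude amplification is needed: the algorithm is a randomized classical one, run reversibly on
  a uniform superposition of seeds. Three ideas give the running time.

  A midpoint of a shortest path segment of length about \<open>2 ^ j\<close> only has to be found up to an error
  of \<open>2 ^ j / log n\<close>, so it suffices to try about \<open>n * log n / 2 ^ j\<close> random vertices instead of \<open>n\<close>.
  The product over the levels \<open>j\<close> is \<open>2 powr (log n)\<^sup>2 / 2\<close>, up to a factor \<open>O(log n)\<close> per level.

  This factor is regained by working with classes of \<open>S = O(log n)\<close> vertices: the set of vertices of a
  class that are reachable from a given set is a bitmap, and one recursive call transports a whole
  bitmap. A large constant in \<open>S\<close> also pays for all constant factors per level.

  Everything is linear over GF(2): a node of the recursion adds the image of a bitmap to another one, so
  intermediate bitmaps are erased by repeating a call. Cancellation is harmless because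
  independent random coins in the leaves make every parity unbiased or biased towards 0, and biases of independent
  contributions multiply. A parity is never 1 without a path, so the error is one-sided.

  As the algorithm may depend on \<open>n\<close>, the randomness is reduced to \<open>O(log n)\<close> bits by fixing
  polynomially many outcomes that work for all graphs simultaneously.
\<close>

section \<open>Random recursion trees\<close>

text \<open>Two constraints shape the construction. A superposition over seeds needs one instruction
  sequence for all of them, so the random trees of a level have a common shape: a seed decides which
  vertices are midpoints and how the coins fall, never which bits an operation reads or flips.
  Looking these data up is affordable because a \<open>Select\<close> whose index register contains
  almost all qubits performs a flip controlled by an arbitrary predicate at unit cost.

  The recursion must also not lose success probability from level to level. The invariant is that
  the average of the sign \<open>chi\<close> of the computed parity is at most 1/4 whenever a short
  enough path exists. A midpoint list that hits a good vertex only guarantees 23/32, and the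
  independent samples of a level bring this back to 1/4. Only at the root is the error reduced
  further, by running eight trees per seed.\<close>

definition avg :: "'a set \<Rightarrow> ('a \<Rightarrow> real) \<Rightarrow> real" where
  "avg A f = sum f A / real (card A)"

lemma avg_const: "finite A \<Longrightarrow> A \<noteq> {} \<Longrightarrow> avg A (\<lambda>_. c) = c"
  by (simp add: avg_def)

lemma avg_mono: "(\<And>a. a \<in> A \<Longrightarrow> f a \<le> g a) \<Longrightarrow> avg A f \<le> avg A g"
  by (simp add: avg_def divide_right_mono sum_mono)

lemma avg_nonneg: "(\<And>a. a \<in> A \<Longrightarrow> 0 \<le> f a) \<Longrightarrow> 0 \<le> avg A f"
  by (simp add: avg_def sum_nonneg)

lemma avg_add: "avg A (\<lambda>a. f a + g a) = avg A f + avg A g"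
  by (simp add: avg_def sum.distrib add_divide_distrib)

lemma avg_mult_left: "avg A (\<lambda>a. c * f a) = c * avg A f"
  by (simp add: avg_def sum_distrib_left)

lemma avg_mult_right: "avg A (\<lambda>a. f a * c) = avg A f * c"
  by (simp add: avg_def sum_distrib_right)

lemma avg_cong: "(\<And>a. a \<in> A \<Longrightarrow> f a = g a) \<Longrightarrow> avg A f = avg A g"
  by (simp add: avg_def)

lemma avg_Times: "avg (A \<times> B) f = avg A (\<lambda>a. avg B (\<lambda>b. f (a, b)))"
  by (cases "finite A \<and> finite B")
     (auto simp: avg_def sum.cartesian_product card_cartesian_product sum_divide_distrib
        field_simps sum.infinite finite_cartesian_product_iff)

lemma avg_image: "inj_on h A \<Longrightarrow> avg (h ` A) f = avg A (\<lambda>a. f (h a))"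
  by (simp add: avg_def sum.reindex card_image)

lemma avg_if:
  assumes "finite A"
  shows "avg A (\<lambda>a. if P a then x else y)
     = (x * card {a \<in> A. P a} + y * card {a \<in> A. \<not> P a}) / card A"
proof -
  have "A \<inter> {a. P a} = {a \<in> A. P a}" "A \<inter> - {a. P a} = {a \<in> A. \<not> P a}" by auto
  then show ?thesis
    unfolding avg_def sum.If_cases[OF assms] by (simp add: mult.commute)
qed

section \<open>Parity trees and their distribution\<close>

definition chi :: "bool \<Rightarrow> real" where "chi b = (if b then - 1 else 1)"

text \<open>The average of \<open>chi\<close> is the probability of 0 minus the probability of 1.
  Turning xor into a product, it factorizes over independent summands, which an error probability
  would not do.\<close>

lemma chi_xor: "chi (a \<noteq> b) = chi a * chi b"
  by (simp add: chi_def)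

lemma chi_le_1: "chi b \<le> 1"
  by (simp add: chi_def)

datatype tree = Leaf "bool list" | Node nat "nat list" tree tree tree

primrec den :: "nat \<Rightarrow> (nat \<times> nat) set \<Rightarrow> tree \<Rightarrow>
    (nat \<Rightarrow> nat) \<Rightarrow> (nat \<Rightarrow> nat) \<Rightarrow> (nat \<Rightarrow> bool) \<Rightarrow> nat \<Rightarrow> bool" where
  "den S E (Leaf c) U V X y = odd (card {x. x < S \<and> c ! x \<and> X x \<and> (U x, V y) \<in> E})"
| "den S E (Node z M l r q) U V X y =
     (den S E r ((!) M) V (den S E l U ((!) M) X) y \<noteq> den S E q U V X y)"

lemma den_cong:
  "(\<And>x. x < S \<Longrightarrow> X x = X' x) \<Longrightarrow> den S E T U V X y = den S E T U V X' y"
proof (induction T arbitrary: U V X X' y)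
  case (Leaf c)
  then have "{x. x < S \<and> c ! x \<and> X x \<and> (U x, V y) \<in> E} = {x. x < S \<and> c ! x \<and> X' x \<and> (U x, V y) \<in> E}"
    by auto
  then show ?case by simp
next
  case (Node z M l r q)
  have "den S E l U ((!) M) X = den S E l U ((!) M) X'"
    using Node.IH(1) Node.prems by blast
  moreover have "den S E q U V X y = den S E q U V X' y"
    using Node.IH(3) Node.prems by blast
  ultimately show ?case by simp
qed

text \<open>An odd count is not empty and a true xor has a true side; at a node the two path pieces
  meet in the midpoint of slot \<open>m\<close>.\<close>

lemma den_sound: "den S E T U V X y \<Longrightarrow> \<exists>x<S. X x \<and> (U x, V y) \<in> E\<^sup>*"
proof (induction T arbitrary: U V X y)
  case (Leaf c)
  then have "{x. x < S \<and> c ! x \<and> X x \<and> (U x, V y) \<in> E} \<noteq> {}"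
    by (metis (no_types, lifting) card.empty den.simps(1) even_zero)
  then show ?case by auto
next
  case (Node z M l r q)
  show ?case
  proof (cases "den S E q U V X y")
    case True
    then show ?thesis by (rule Node.IH(3))
  next
    case False
    then have "den S E r ((!) M) V (den S E l U ((!) M) X) y"
      using Node.prems by simp
    then obtain m where m: "m < S" "den S E l U ((!) M) X m" "(M ! m, V y) \<in> E\<^sup>*"
      using Node.IH(2) by blast
    then obtain x where "x < S" "X x" "(U x, M ! m) \<in> E\<^sup>*"
      using Node.IH(1) by blast
    then show ?thesis using m by (meson rtrancl_trans)
  qed
qed

definition vlists :: "nat \<Rightarrow> nat \<Rightarrow> nat list set" where
  "vlists n S = {M. set M \<subseteq> {..<n} \<and> length M = S}"

definition mids :: "nat \<Rightarrow> nat \<Rightarrow> nat \<Rightarrow> tree set \<Rightarrow> tree set \<Rightarrow> tree set" where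
  "mids n S z A Q = (\<lambda>(M, l, r, q). Node z M l r q) ` (vlists n S \<times> A \<times> A \<times> Q)"

text \<open>A tree of level \<open>Suc j\<close> is a chain of \<open>N j\<close> nodes, each with a
  fresh midpoint list and two fresh subtrees of level \<open>j\<close>, ending in one more tree of
  level \<open>j\<close>. The end of the chain serves the pairs already in range at level
  \<open>j\<close>. Since the node constructor is injective, a uniform element of the set has
  independent uniform components.\<close>

primrec trees :: "nat \<Rightarrow> nat \<Rightarrow> (nat \<Rightarrow> nat) \<Rightarrow> nat \<Rightarrow> tree set" where
  "trees n S N 0 = Leaf ` {c. set c \<subseteq> UNIV \<and> length c = S}"
| "trees n S N (Suc j) = (mids n S j (trees n S N j) ^^ N j) (trees n S N j)"

lemma trees_Suc_induct:
  assumes "T \<in> trees n S N (Suc j)"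
    and "\<And>T. T \<in> trees n S N j \<Longrightarrow> P T"
    and "\<And>M l r q. M \<in> vlists n S \<Longrightarrow> l \<in> trees n S N j \<Longrightarrow> r \<in> trees n S N j \<Longrightarrow> P q \<Longrightarrow>
       P (Node j M l r q)"
  shows "P T"
proof -
  have "T \<in> (mids n S j (trees n S N j) ^^ i) (trees n S N j) \<Longrightarrow> P T" for i
    by (induction i arbitrary: T) (use assms(2,3) in \<open>auto simp: mids_def\<close>)
  then show ?thesis using assms(1) by simp
qed

lemma vlists_finite: "finite (vlists n S)" and vlists_nonempty: "0 < n \<Longrightarrow> vlists n S \<noteq> {}"
proof -
  show "finite (vlists n S)"
    unfolding vlists_def by (rule finite_lists_length_eq) simp
  show "vlists n S \<noteq> {}" if "0 < n"
  proof -
    have "replicate S 0 \<in> vlists n S" using that by (auto simp: vlists_def)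
    then show ?thesis by blast
  qed
qed

lemma mids_finite: "finite A \<Longrightarrow> finite Q \<Longrightarrow> finite (mids n S z A Q)"
  unfolding mids_def by (intro finite_imageI finite_cartesian_product vlists_finite)

lemma mids_nonempty: "0 < n \<Longrightarrow> A \<noteq> {} \<Longrightarrow> Q \<noteq> {} \<Longrightarrow> mids n S z A Q \<noteq> {}"
  unfolding mids_def using vlists_nonempty[of n S] by auto

lemma trees_finite: "finite (trees n S N j)"
proof (induction j)
  case 0
  show ?case
    unfolding trees.simps by (intro finite_imageI finite_lists_length_eq) simp
next
  case (Suc j)
  have "finite ((mids n S j (trees n S N j) ^^ i) (trees n S N j))" for i
    by (induction i) (use Suc in \<open>auto intro: mids_finite\<close>)
  then show ?case by simp
qed

lemma trees_nonempty: "0 < n \<Longrightarrow> trees n S N j \<noteq> {}"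
proof (induction j)
  case 0
  have "Leaf (replicate S True) \<in> trees n S N 0" by simp
  then show ?case by blast
next
  case (Suc j)
  then have trees: "trees n S N j \<noteq> {}" by simp
  have "(mids n S j (trees n S N j) ^^ i) (trees n S N j) \<noteq> {}" for i
  proof (induction i)
    case (Suc i)
    then show ?case using \<open>0 < n\<close> trees by (simp add: mids_nonempty)
  qed (use trees in simp)
  then show ?case by simp
qed

text \<open>The summand \<open>q\<close> is independent of the route through \<open>M\<close>, so
  its bias splits off as a factor. The biases of \<open>l\<close> and \<open>r\<close> do not split,
  as \<open>r\<close> works on the output of \<open>l\<close>.\<close>

lemma avg_mids:
  "avg (mids n S z A Q) (\<lambda>T. chi (den S E T U V X y)) =
   avg (vlists n S) (\<lambda>M. avg A (\<lambda>l. avg A (\<lambda>r.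
     chi (den S E r ((!) M) V (den S E l U ((!) M) X) y)))) *
   avg Q (\<lambda>T. chi (den S E T U V X y))"
proof -
  have inj: "inj_on (\<lambda>(M, l, r, q). Node z M l r q) (vlists n S \<times> A \<times> A \<times> Q)"
    by (auto simp: inj_on_def)
  show ?thesis
    unfolding mids_def avg_image[OF inj]
    by (simp only: avg_Times den.simps chi_xor avg_mult_left avg_mult_right prod.case)
qed

lemma avg_trees_Suc:
  "avg (trees n S N (Suc j)) (\<lambda>T. chi (den S E T U V X y)) =
   avg (vlists n S) (\<lambda>M. avg (trees n S N j) (\<lambda>l. avg (trees n S N j) (\<lambda>r.
     chi (den S E r ((!) M) V (den S E l U ((!) M) X) y)))) ^ N j *
   avg (trees n S N j) (\<lambda>T. chi (den S E T U V X y))"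
proof -
  have "avg ((mids n S j A ^^ i) Q) (\<lambda>T. chi (den S E T U V X y)) =
   avg (vlists n S) (\<lambda>M. avg A (\<lambda>l. avg A (\<lambda>r.
     chi (den S E r ((!) M) V (den S E l U ((!) M) X) y)))) ^ i *
   avg Q (\<lambda>T. chi (den S E T U V X y))" for i A Q
    by (induction i) (simp_all add: avg_mids)
  then show ?thesis by simp
qed

section \<open>Bias of a leaf and gain of one level\<close>

lemma odd_card_flip:
  assumes "finite B" "x \<in> B" and that: "x < length c"
  shows "odd (card {i \<in> B. (c[x := \<not> c ! x]) ! i}) = (\<not> odd (card {i \<in> B. c ! i}))"
proof -
  let ?D = "{i \<in> B - {x}. c ! i}"
  have D: "finite ?D" "x \<notin> ?D" using assms by auto
  show ?thesis
  proof (cases "c ! x")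
    case True
    have "{i \<in> B. (c[x := \<not> c ! x]) ! i} = ?D" "{i \<in> B. c ! i} = insert x ?D"
      using True that assms(2) by (auto simp: nth_list_update)
    then show ?thesis using D by simp
  next
    case False
    have "{i \<in> B. (c[x := \<not> c ! x]) ! i} = insert x ?D" "{i \<in> B. c ! i} = ?D"
      using False that assms(2) by (auto simp: nth_list_update)
    then show ?thesis using D by simp
  qed
qed

text \<open>Toggling the coin of \<open>x\<close> is an involution that reverses the sign of every
  term.\<close>

lemma sum_chi_coins:
  assumes "x < S" "x \<in> B" "finite B"
  shows "(\<Sum>c | set c \<subseteq> UNIV \<and> length c = S. chi (odd (card {i \<in> B. c ! i}))) = 0" (is "sum ?f ?C = 0")
proof -
  let ?g = "\<lambda>c :: bool list. c[x := \<not> c ! x]"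
  have "sum ?f ?C = (\<Sum>c\<in>?C. ?f (?g c))"
  proof (rule sum.reindex_bij_witness[of _ ?g ?g])
  qed (use assms in \<open>auto simp: list_update_same_conv\<close>)
  also have "\<dots> = (\<Sum>c\<in>?C. - ?f c)"
    by (rule sum.cong) (use assms odd_card_flip[OF assms(3,2)] in \<open>auto simp: chi_def\<close>)
  also have "\<dots> = - sum ?f ?C" by (simp add: sum_negf)
  finally show ?thesis by simp
qed

text \<open>The coin of a marked predecessor of \<open>V y\<close> makes the parity exactly fair;
  without such a predecessor the sum is empty and the parity is 0.\<close>

lemma avg_leaf:
  "avg (trees n S N 0) (\<lambda>T. chi (den S E T U V X y)) =
     (if \<exists>x<S. X x \<and> (U x, V y) \<in> E then 0 else 1)"
proof -
  define B where "B = {x. x < S \<and> X x \<and> (U x, V y) \<in> E}"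
  have B: "finite B" by (simp add: B_def)
  have eq: "{x. x < S \<and> c ! x \<and> X x \<and> (U x, V y) \<in> E} = {i \<in> B. c ! i}" for c
    by (auto simp: B_def)
  have *: "avg (trees n S N 0) (\<lambda>T. chi (den S E T U V X y)) =
      avg {c. set c \<subseteq> UNIV \<and> length c = S} (\<lambda>c. chi (odd (card {i \<in> B. c ! i})))"
    unfolding trees.simps by (subst avg_image) (simp_all add: eq inj_on_def)
  show ?thesis
  proof (cases "B = {}")
    case True
    have fin: "finite {c :: bool list. set c \<subseteq> UNIV \<and> length c = S}"
      by (rule finite_lists_length_eq) simp
    moreover have "replicate S True \<in> {c :: bool list. set c \<subseteq> UNIV \<and> length c = S}" by simp
    ultimately have "avg {c :: bool list. set c \<subseteq> UNIV \<and> length c = S} (\<lambda>_. 1) = 1"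
      by (intro avg_const) blast+
    then have "avg (trees n S N 0) (\<lambda>T. chi (den S E T U V X y)) = 1"
      unfolding * using True by (simp add: chi_def)
    moreover have "\<not> (\<exists>x<S. X x \<and> (U x, V y) \<in> E)" using True B_def by auto
    ultimately show ?thesis by simp
  next
    case False
    then obtain x where x: "x \<in> B" by blast
    then have "x < S" by (simp add: B_def)
    have "avg (trees n S N 0) (\<lambda>T. chi (den S E T U V X y)) = 0"
      unfolding * unfolding avg_def by (subst sum_chi_coins[OF \<open>x < S\<close> x B]) simp
    then show ?thesis using x B_def by auto
  qed
qed

text \<open>For fixed \<open>M\<close> and \<open>l\<close>, the average over \<open>r\<close> is
  again a bias of level \<open>j\<close>, now started from the output of \<open>l\<close>; hence the
  induction over all bitmaps. The sign is needed to take powers and products of upper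
  bounds.\<close>

lemma bias_nonneg: "0 \<le> avg (trees n S N j) (\<lambda>T. chi (den S E T U V X y))"
proof (induction j arbitrary: U V X y)
  case 0
  then show ?case by (simp only: avg_leaf) simp
next
  case (Suc j)
  show ?case
    unfolding avg_trees_Suc by (intro mult_nonneg_nonneg zero_le_power avg_nonneg Suc)
qed

text \<open>An elementary substitute for (1 - y)^m <= exp(- m y): Bernoulli gives 1 + m y <= (1 +
  y)^m, and (1 - y)(1 + y) <= 1.\<close>

lemma power_one_minus_le:
  fixes y :: real
  assumes "0 \<le> y" "y \<le> 1"
  shows "(1 - y) ^ m * (1 + m * y) \<le> 1"
proof -
  have "(1 - y) ^ m * (1 + m * y) \<le> (1 - y) ^ m * (1 + y) ^ m"
    by (rule mult_left_mono) (use assms Bernoulli_inequality[of y m] in auto)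
  also have "\<dots> = (1 - y\<^sup>2) ^ m"
    by (simp add: power_mult_distrib[symmetric] algebra_simps power2_eq_square)
  also have "\<dots> \<le> 1"
    using assms by (intro power_le_one) (auto simp: power_le_one)
  finally show ?thesis .
qed

lemma card_vlists: "card (vlists n S) = n ^ S"
  using card_lists_length_eq[of "{..<n}" S] by (simp add: vlists_def)

lemma miss_fraction:
  assumes "W \<subseteq> {..<n}" "0 < n"
  shows "card {M \<in> vlists n S. \<not> (\<exists>m<S. M ! m \<in> W)} = (n - card W) ^ S"
proof -
  have "{M \<in> vlists n S. \<not> (\<exists>m<S. M ! m \<in> W)} = {M. set M \<subseteq> {..<n} - W \<and> length M = S}"
    by (fastforce simp: vlists_def in_set_conv_nth)
  then show ?thesis
    using card_lists_length_eq[of "{..<n} - W" S] assms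
    by (simp add: card_Diff_subset finite_subset)
qed

text \<open>Let x = S |W| / n be the expected number of hits of \<open>W\<close> by a list. A list
  misses \<open>W\<close> with probability q <= 1/(1 + x), so N (1 - q) >= N x / (1 + x) >= 16: the
  second bound on \<open>N\<close> covers small x, the bound 32 <= N covers large x. With a gain of
  9/32 on every hit the average is at most 1 - y where N y >= 9/2, and the power is at most 1/(1 +
  3).\<close>

lemma bias_step:
  assumes n: "0 < n" and W: "W \<subseteq> {..<n}" "real w \<le> real (card W)"
    and N: "32 \<le> N" "32 * real n \<le> real N * real S * real w"
    and f: "\<And>M. M \<in> vlists n S \<Longrightarrow> f M \<le> 1" "\<And>M. M \<in> vlists n S \<Longrightarrow> 0 \<le> f M"
      "\<And>M m. M \<in> vlists n S \<Longrightarrow> m < S \<Longrightarrow> M ! m \<in> W \<Longrightarrow> f M \<le> 23 / 32"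
  shows "avg (vlists n S) f ^ N \<le> 1 / 4"
proof -
  let ?P = "\<lambda>M. \<not> (\<exists>m<S. M ! m \<in> W)"
  have cW: "card W \<le> n" using card_mono[OF _ W(1)] by simp
  define v where "v = real (card W) / real n"
  define x where "x = real S * v"
  define q where "q = (1 - v) ^ S"
  have v: "0 \<le> v" "v \<le> 1" using cW n by (auto simp: v_def)
  have q0: "0 \<le> q" "q \<le> 1" using v by (auto simp: q_def power_le_one)
  have x: "0 \<le> x" using v by (simp add: x_def)
  have qx: "q * (1 + x) \<le> 1" using power_one_minus_le[OF v, of S] by (simp add: q_def x_def)
  have "avg (vlists n S) f \<le> avg (vlists n S) (\<lambda>M. if ?P M then 1 else 23 / 32)"
    by (rule avg_mono) (use f in auto)
  also have "\<dots> = avg (vlists n S) (\<lambda>M. 23 / 32 + (if ?P M then 9/32 else 0))"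
    by (rule avg_cong) auto
  also have "\<dots> = 23 / 32 + 9 / 32 * (card {M \<in> vlists n S. ?P M} / card (vlists n S))"
    unfolding avg_add using avg_const[OF vlists_finite vlists_nonempty[OF n]]
    by (simp add: avg_if vlists_finite)
  also have "card {M \<in> vlists n S. ?P M} / real (card (vlists n S)) = q"
    unfolding miss_fraction[OF W(1) n] card_vlists q_def v_def
    using cW n by (simp add: power_divide[symmetric] of_nat_diff diff_divide_distrib)
  finally have "avg (vlists n S) f \<le> 23 / 32 + 9 / 32 * q" .
  then have c: "avg (vlists n S) f \<le> 1 - 9 / 32 * (1 - q)" unfolding right_diff_distrib by linarith
  have c0: "0 \<le> avg (vlists n S) f" using f(2) by (rule avg_nonneg)
  have Nx: "32 \<le> N * x"
  proof -
    have "32 * real n \<le> real N * real S * real (card W)"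
      by (rule order_trans[OF N(2)]) (intro mult_left_mono W(2) mult_nonneg_nonneg of_nat_0_le_iff)
    then have "32 \<le> real N * real S * real (card W) / real n" using n by (simp add: pos_le_divide_eq)
    then show ?thesis by (simp add: x_def v_def mult.assoc)
  qed
  have "32 * (1 + x) \<le> N * x * 2"
  proof -
    have "32 * x \<le> N * x" using N(1) x by (simp add: mult_right_mono)
    then show ?thesis using Nx by simp
  qed
  have "16 \<le> N * (1 - q)"
  proof -
    have "x \<le> (1 - q) * (1 + x)" using qx by (simp add: algebra_simps)
    then have "N * x \<le> N * ((1 - q) * (1 + x))" by (simp add: mult_left_mono)
    then have "16 * (1 + x) \<le> (N * (1 - q)) * (1 + x)"
      using \<open>32 * (1 + x) \<le> N * x * 2\<close> by (simp add: mult.assoc)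
    then show ?thesis using x mult_right_le_imp_le[of 16 "1 + x" "N * (1 - q)"] by simp
  qed
  define y where "y = 9 / 32 * (1 - q)"
  have y: "0 \<le> y" "y \<le> 1" using q0 by (auto simp: y_def)
  have "9 / 32 * 16 \<le> 9 / 32 * (N * (1 - q))"
    using \<open>16 \<le> N * (1 - q)\<close> by (rule mult_left_mono) simp
  moreover have "N * y = 9 / 32 * (N * (1 - q))" unfolding y_def by (rule mult.left_commute)
  moreover have "(3::real) \<le> 9 / 32 * 16" by simp
  ultimately have "3 \<le> N * y" by (metis order_trans)
  have "(1 - y) ^ N * 4 \<le> (1 - y) ^ N * (1 + N * y)"
    by (rule mult_left_mono) (use \<open>3 \<le> N * y\<close> y in auto)
  also have "\<dots> \<le> 1" by (rule power_one_minus_le[OF y])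
  finally have "(1 - y) ^ N \<le> 1 / 4" by simp
  moreover have "avg (vlists n S) f ^ N \<le> (1 - y) ^ N"
    using c c0 by (intro power_mono) (auto simp: y_def)
  ultimately show ?thesis by simp
qed

section \<open>Shortest paths, midpoint windows and the path lengths of the levels\<close>

definition reach :: "(nat \<times> nat) set \<Rightarrow> nat \<Rightarrow> (nat \<times> nat) set" where
  "reach E m = (\<Union>d\<le>m. E ^^ d)"


text \<open>The vertices of a shortest walk are distinct, as the part between two equal ones could
  be cut out. This is what turns a range of positions into equally many midpoints.\<close>

lemma shortest_path:
  assumes E: "E \<subseteq> {..<n} \<times> {..<n}" "x < n" and d0: "(x, y) \<in> E ^^ d0"
  obtains d f where "(x, y) \<in> E ^^ d" "\<And>e. (x, y) \<in> E ^^ e \<Longrightarrow> d \<le> e"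
    "f 0 = x" "f d = y" "\<And>a b. a + b \<le> d \<Longrightarrow> (f a, f (a + b)) \<in> E ^^ b"
    "\<And>i. i \<le> d \<Longrightarrow> f i < n" "inj_on f {..d}"
proof -
  define d where "d = (LEAST d. (x, y) \<in> E ^^ d)"
  have xy: "(x, y) \<in> E ^^ d" unfolding d_def by (rule LeastI) fact
  have least: "d \<le> e" if "(x, y) \<in> E ^^ e" for e
    unfolding d_def by (rule Least_le) fact
  obtain f where f: "f 0 = x" "f d = y" "\<And>i. i < d \<Longrightarrow> (f i, f (Suc i)) \<in> E"
    using xy by (auto simp: relpow_fun_conv)
  have seg: "(f a, f (a + b)) \<in> E ^^ b" if "a + b \<le> d" for a b
    using that
  proof (induction b)
    case (Suc b)
    then show ?case using f(3)[of "a + b"] by (auto intro: relpow_Suc_I)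
  qed simp
  have fn: "f i < n" if "i \<le> d" for i
  proof (cases i)
    case (Suc i')
    then show ?thesis using that f(3)[of i'] E by auto
  qed (use f E in simp)
  have "inj_on f {..d}"
  proof (rule linorder_inj_onI')
    fix i j assume ij: "i \<in> {..d}" "j \<in> {..d}" "i < j"
    show "f i \<noteq> f j"
    proof
      assume eq: "f i = f j"
      have "(x, f j) \<in> E ^^ i" using seg[of 0 i] ij f(1) eq by simp
      moreover have "(f j, y) \<in> E ^^ (d - j)" using seg[of j "d - j"] ij f(2) by simp
      ultimately have "(x, y) \<in> E ^^ (i + (d - j))" unfolding relpow_add by (rule relcompI)
      then show False using least[of "i + (d - j)"] ij by auto
    qed
  qed
  with that xy least f(1,2) seg fn show ?thesis by blast
qed

text \<open>A shortest path of length d has d + 1 distinct vertices, so d < n.\<close>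

lemma rtrancl_reach:
  assumes "E \<subseteq> {..<n} \<times> {..<n}" "x < n" "(x, y) \<in> E\<^sup>*" "n \<le> L"
  shows "(x, y) \<in> reach E L"
proof -
  obtain d0 where "(x, y) \<in> E ^^ d0" using assms(3) by (auto simp: rtrancl_power)
  from shortest_path[OF assms(1,2) this] obtain d f
    where d: "(x, y) \<in> E ^^ d" "\<And>i. i \<le> d \<Longrightarrow> f i < n" "inj_on f {..d}"
    by metis
  have "card (f ` {..d}) \<le> card {..<n}" using d(2) by (intro card_mono) auto
  then have "d < n" using d(3) by (simp add: card_image)
  then show ?thesis using d(1) assms(4) by (auto simp: reach_def)
qed

text \<open>On a shortest path of length d, each position from d - L to L leaves pieces of length at
  most L on both sides. There are 2 L + 1 - d >= w such positions.\<close>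

lemma reach_window:
  assumes E: "E \<subseteq> {..<n} \<times> {..<n}" "x < n"
    and d: "(x, y) \<in> reach E L'" "(x, y) \<notin> reach E L" and L: "L' + w \<le> 2 * L + 1"
  shows "\<exists>W \<subseteq> {..<n}. w \<le> card W \<and> (\<forall>m\<in>W. (x, m) \<in> reach E L \<and> (m, y) \<in> reach E L)"
proof -
  obtain d0 where d0: "d0 \<le> L'" "(x, y) \<in> E ^^ d0" using d(1) by (auto simp: reach_def)
  from shortest_path[OF E d0(2)] obtain d f where xy: "(x, y) \<in> E ^^ d"
    and least: "\<And>e. (x, y) \<in> E ^^ e \<Longrightarrow> d \<le> e"
    and f: "f 0 = x" "f d = y" "\<And>a b. a + b \<le> d \<Longrightarrow> (f a, f (a + b)) \<in> E ^^ b"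
    and fn: "\<And>i. i \<le> d \<Longrightarrow> f i < n" and inj: "inj_on f {..d}"
    by metis
  have dL: "d \<le> L'" "L < d"
    using least[OF d0(2)] d0(1) xy d(2) by (auto simp: reach_def not_le[symmetric])
  let ?I = "{d - L..L}"
  have "inj_on f ?I" using inj by (rule inj_on_subset) (use dL in auto)
  then have "w \<le> card (f ` ?I)" using dL L by (simp add: card_image)
  moreover have "f ` ?I \<subseteq> {..<n}" using fn dL by auto
  moreover have "(x, f i) \<in> reach E L \<and> (f i, y) \<in> reach E L" if "i \<in> ?I" for i
    using f(3)[of 0 i] f(3)[of i "d - i"] that dL f(1,2) by (auto simp: reach_def)
  ultimately show ?thesis by blast
qed

text \<open>The path length covered at level \<open>j\<close>. Falling short of a doubling by the
  fraction 1/\<kappa> of the current length leaves a window of more than that many good midpoints,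
  and over \<kappa> levels the losses cost only a factor 2 in total.\<close>

primrec range_len :: "nat \<Rightarrow> nat \<Rightarrow> nat" where
  "range_len \<kappa> 0 = 1"
| "range_len \<kappa> (Suc j) = 2 * range_len \<kappa> j - range_len \<kappa> j div \<kappa>"

text \<open>Each level multiplies the length by at least 2 (1 - e) with e = 1/(2 \<kappa>), and the
  product of the factors 1 - e is bounded as in Bernoulli's inequality.\<close>

lemma range_len_ge:
  assumes "0 < \<kappa>"
  shows "2 ^ j * (1 - j / (2 * real \<kappa>)) \<le> range_len \<kappa> j"
proof (cases "j \<le> 2 * \<kappa>")
  case True
  then show ?thesis
  proof (induction j)
    case (Suc j)
    let ?r = "real (range_len \<kappa> j)"
    let ?e = "1 / (2 * real \<kappa>)"
    have "real (range_len \<kappa> j div \<kappa>) \<le> ?r / \<kappa>" by (rule of_nat_div_le_of_nat)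
    moreover have "range_len \<kappa> j div \<kappa> \<le> 2 * range_len \<kappa> j"
      using div_le_dividend[of "range_len \<kappa> j" \<kappa>] by linarith
    ultimately have *: "?r * (2 * (1 - ?e)) \<le> range_len \<kappa> (Suc j)"
      using assms by (simp add: of_nat_diff field_simps)
    have "1 \<le> real \<kappa>" using assms by simp
    then have e: "0 \<le> ?e" "?e \<le> 1" by (auto simp: field_simps)
    have "2 ^ Suc j * (1 - Suc j / (2 * real \<kappa>)) = 2 * 2 ^ j * (1 - j * ?e - ?e)"
      by (simp add: add_divide_distrib)
    also have "\<dots> \<le> 2 * 2 ^ j * ((1 - j * ?e) * (1 - ?e))"
      using e by (intro mult_left_mono) (simp_all add: algebra_simps)
    also have "\<dots> = (2 ^ j * (1 - j * ?e)) * (2 * (1 - ?e))" by simp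
    also have "\<dots> \<le> ?r * (2 * (1 - ?e))"
    proof (rule mult_right_mono)
      show "2 ^ j * (1 - j * ?e) \<le> ?r" using Suc by simp
      show "0 \<le> 2 * (1 - ?e)" by (rule mult_nonneg_nonneg) (use e(2) in simp_all)
    qed
    finally show ?case using * by linarith
  qed simp
next
  case False
  then have "1 - j / (2 * real \<kappa>) \<le> 0" using assms by (simp add: field_simps)
  then have "2 ^ j * (1 - j / (2 * real \<kappa>)) \<le> 0" by (simp add: mult_nonneg_nonpos)
  then show ?thesis by linarith
qed

lemma range_len_ge_half: "j \<le> \<kappa> \<Longrightarrow> 0 < \<kappa> \<Longrightarrow> 2 ^ j / 2 \<le> real (range_len \<kappa> j)"
proof -
  assume j: "j \<le> \<kappa>" "0 < \<kappa>"
  have "(2::real) ^ j * (1 / 2) \<le> 2 ^ j * (1 - j / (2 * real \<kappa>))"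
    using j by (intro mult_left_mono) (auto simp: field_simps)
  then show ?thesis using range_len_ge[OF j(2), of j] by linarith
qed

text \<open>The number \<kappa> is the inverse window fraction and bounds the number of levels.
  \<open>NS_ge\<close> says that the \<open>N j * S\<close> vertices sampled at a level hit a window
  of size 2^j / (2 \<kappa>) at least 32 times on average; the factor 2 between 64 and 32 pays for
  the shortfall in \<open>range_len_ge_half\<close>.\<close>

locale sampling =
  fixes n S :: nat and N :: "nat \<Rightarrow> nat" and \<kappa> :: nat
  assumes n: "0 < n" and \<kappa>: "0 < \<kappa>"
    and N_ge: "32 \<le> N j"
    and NS_ge: "j \<le> \<kappa> \<Longrightarrow> 64 * n * \<kappa> \<le> N j * S * 2 ^ j"
begin

lemma NS_window:
  assumes "j \<le> \<kappa>"
  shows "32 * real n \<le> real (N j) * real S * real (range_len \<kappa> j div \<kappa> + 1)"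
proof -
  have "2 ^ j / 2 \<le> real (range_len \<kappa> j)" using assms \<kappa> by (rule range_len_ge_half)
  also have "\<dots> \<le> real (\<kappa> * (range_len \<kappa> j div \<kappa> + 1))"
  proof -
    have "range_len \<kappa> j < \<kappa> + \<kappa> * (range_len \<kappa> j div \<kappa>)"
      using dividend_less_div_times[OF \<kappa>] by (simp add: mult.commute)
    then show ?thesis unfolding of_nat_le_iff by simp
  qed
  finally have *: "2 ^ j \<le> 2 * real \<kappa> * real (range_len \<kappa> j div \<kappa> + 1)"
    by (simp add: algebra_simps)
  have "64 * real n * real \<kappa> \<le> real (N j) * real S * 2 ^ j"
    using of_nat_mono[OF NS_ge[OF assms], where 'a = real] by simp
  also have "\<dots> \<le> real (N j) * real S * (2 * real \<kappa> * real (range_len \<kappa> j div \<kappa> + 1))"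
    using * by (intro mult_left_mono) auto
  finally have "64 * real n \<le> real (N j) * (real S * (2 + 2 * real (range_len \<kappa> j div \<kappa>)))"
    using \<kappa> by simp
  then show ?thesis by (simp add: algebra_simps)
qed

text \<open>The bound 1/4 reproduces itself. A pair already in range one level below is handled by
  the end of the chain, whose bias is at most 1/4 while the other factors are at most 1. Otherwise
  there is a window of midpoints, and the samples achieve 1/4 by \<open>bias_step\<close>.\<close>

lemma bias_le:
  assumes E: "E \<subseteq> {..<n} \<times> {..<n}" "\<And>v. v < n \<Longrightarrow> (v, v) \<in> E"
    and "j \<le> \<kappa>" "x < S" "X x" "U x < n" "(U x, V y) \<in> reach E (range_len \<kappa> j)"
  shows "avg (trees n S N j) (\<lambda>T. chi (den S E T U V X y)) \<le> 1 / 4"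
  using assms(3-7)
proof (induction j arbitrary: x X y U V)
  case 0
  from 0(5) have "(U x, V y) \<in> E"
  proof -
    obtain d where "d \<le> 1" "(U x, V y) \<in> E ^^ d" using 0(5) by (auto simp: reach_def)
    \<comment> \<open>A walk of length 0 is replaced by the loop at its vertex.\<close>
    then show ?thesis using E(2)[OF 0(4)] by (cases "d = 0") (auto simp: le_Suc_eq)
  qed
  then have "\<exists>x<S. X x \<and> (U x, V y) \<in> E" using 0 by blast
  then show ?case by (simp only: avg_leaf if_True)
next
  case (Suc j)
  let ?A = "trees n S N j"
  let ?h = "\<lambda>M l r. chi (den S E r ((!) M) V (den S E l U ((!) M) X) y)"
  let ?f = "\<lambda>M. avg ?A (\<lambda>l. avg ?A (?h M l))"
  have fin: "finite ?A" "?A \<noteq> {}" by (rule trees_finite, rule trees_nonempty[OF n])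
  have le1: "avg ?A (?h M l) \<le> 1" for M l
    using avg_mono[of ?A "?h M l" "\<lambda>_. 1"] avg_const[OF fin] chi_le_1 by simp
  have f: "?f M \<le> 1" for M
    using avg_mono[of ?A "\<lambda>l. avg ?A (?h M l)" "\<lambda>_. 1"] avg_const[OF fin] le1 by simp
  have f0: "0 \<le> ?f M" for M by (intro avg_nonneg bias_nonneg)
  have c: "avg (vlists n S) ?f \<le> 1" "0 \<le> avg (vlists n S) ?f"
    using avg_mono[of "vlists n S" ?f "\<lambda>_. 1"] avg_const[OF vlists_finite vlists_nonempty[OF n]] f f0
    by (auto intro: avg_nonneg)
  have q: "0 \<le> avg ?A (\<lambda>T. chi (den S E T U V X y))" by (rule bias_nonneg)
  show ?case
  proof (cases "(U x, V y) \<in> reach E (range_len \<kappa> j)")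
    case True
    then have "avg ?A (\<lambda>T. chi (den S E T U V X y)) \<le> 1 / 4"
      using Suc.IH[of x X U V y] Suc.prems by simp
    moreover have "avg (vlists n S) ?f ^ N j \<le> 1" using c by (rule power_le_one[rotated])
    ultimately show ?thesis
      unfolding avg_trees_Suc using mult_mono[of "avg (vlists n S) ?f ^ N j" 1 _ "1/4"] q by simp
  next
    case False
    let ?w = "range_len \<kappa> j div \<kappa> + 1"
    have "range_len \<kappa> j div \<kappa> \<le> range_len \<kappa> j" by (rule div_le_dividend)
    then have "range_len \<kappa> (Suc j) + ?w \<le> 2 * range_len \<kappa> j + 1"
      unfolding range_len.simps by linarith
    from reach_window[OF E(1) Suc.prems(4) Suc.prems(5) False this]
    obtain W where W: "W \<subseteq> {..<n}" "?w \<le> card W"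
      "\<And>m. m \<in> W \<Longrightarrow> (U x, m) \<in> reach E (range_len \<kappa> j)"
      "\<And>m. m \<in> W \<Longrightarrow> (m, V y) \<in> reach E (range_len \<kappa> j)"
      by blast
    have "?f M \<le> 23 / 32" if m: "m < S" "M ! m \<in> W" for M m
    proof -
      \<comment> \<open>Linear interpolation in \<open>chi\<close>: the bias of \<open>r\<close> is
        at most 1/4 if \<open>l\<close> has set bit \<open>m\<close>, where \<open>chi\<close> is
        -1, and at most 1 otherwise. Averaging over \<open>l\<close> gives 5/8 + 3/8 * 1/4 =
        23/32.\<close>
      have "avg ?A (?h M l) \<le> 5 / 8 + 3 / 8 * chi (den S E l U ((!) M) X m)" for l
      proof (cases "den S E l U ((!) M) X m")
        case True
        then have "avg ?A (?h M l) \<le> 1 / 4"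
          using Suc.IH[of m "den S E l U ((!) M) X" "(!) M" V y] Suc.prems m W by auto
        then show ?thesis using True by (simp add: chi_def)
      qed (use le1 in \<open>simp add: chi_def\<close>)
      then have "?f M \<le> avg ?A (\<lambda>l. 5 / 8 + 3 / 8 * chi (den S E l U ((!) M) X m))"
        by (rule avg_mono)
      also have "\<dots> = 5 / 8 + 3 / 8 * avg ?A (\<lambda>l. chi (den S E l U ((!) M) X m))"
        by (simp only: avg_add avg_mult_left avg_const[OF fin])
      also have "avg ?A (\<lambda>l. chi (den S E l U ((!) M) X m)) \<le> 1 / 4"
        using Suc.IH[of x X U "(!) M" m] Suc.prems m W by auto
      finally show ?thesis by simp
    qed
    then have "avg (vlists n S) ?f ^ N j \<le> 1 / 4"
      using bias_step[OF n W(1), of ?w "N j" S ?f] W(2) N_ge[of j] NS_window[of j] Suc.prems(1) f f0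
      by simp
    then show ?thesis
      unfolding avg_trees_Suc
      using mult_mono[of "avg (vlists n S) ?f ^ N j" "1/4" "avg ?A (\<lambda>T. chi (den S E T U V X y))" 1] q
        avg_mono[of ?A "\<lambda>T. chi (den S E T U V X y)" "\<lambda>_. 1"] avg_const[OF fin] chi_le_1 by simp
  qed
qed

end

section \<open>Fixing polynomially many seeds for all graphs\<close>

definition forests :: "nat \<Rightarrow> tree set \<Rightarrow> tree list set" where
  "forests R A = {F. set F \<subseteq> A \<and> length F = R}"

text \<open>Multiplicative weights: the weight of an input is multiplied by 8 whenever the chosen outcome is bad for it,
  and each outcome is chosen so that the total weight grows by at most its average factor.\<close>

lemma newman:
  assumes A: "finite A" "A \<noteq> {}" and I: "finite I"
    and bad: "\<And>i. i \<in> I \<Longrightarrow> 18 * card {a \<in> A. bad i a} \<le> card A"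
  shows "\<exists>f. (\<forall>m<M. f m \<in> A) \<and>
    (\<Sum>i\<in>I. 8 ^ card {m. m < M \<and> bad i (f m)}) \<le> real (card I) * (25 / 18) ^ M"
proof (induction M)
  case 0
  show ?case by (rule exI[of _ undefined]) simp
next
  case (Suc M)
  then obtain f where f: "\<forall>m<M. f m \<in> A"
    "(\<Sum>i\<in>I. 8 ^ card {m. m < M \<and> bad i (f m)}) \<le> real (card I) * (25 / 18) ^ M" by blast
  define w :: "_ \<Rightarrow> real" where "w i = 8 ^ card {m. m < M \<and> bad i (f m)}" for i
  have w: "0 \<le> w i" for i by (simp add: w_def)
  have cA: "0 < card A" using A by (simp add: card_gt_0_iff)
  let ?g = "\<lambda>i a. w i * (if bad i a then 8 else 1)"
  have one: "avg A (?g i) \<le> w i * (25 / 18)" if "i \<in> I" for i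
  proof -
    have "avg A (\<lambda>a. if bad i a then 8 else 1) = avg A (\<lambda>a. 1 + (if bad i a then 7 else 0))"
      by (rule avg_cong) auto
    also have "\<dots> = 1 + 7 * card {a \<in> A. bad i a} / card A"
      unfolding avg_add using avg_const[OF A] by (simp add: avg_if A)
    \<comment> \<open>At most 1/18 of the outcomes are bad, and 1 + 7/18 = 25/18.\<close>
    also have "\<dots> \<le> 25 / 18"
    proof -
      have "18 * real (card {a \<in> A. bad i a}) \<le> card A"
        using of_nat_mono[OF bad[OF that], where 'a = real] by simp
      then show ?thesis using cA by (simp add: field_simps)
    qed
    finally show ?thesis using w[of i] by (simp only: avg_mult_left) (rule mult_left_mono)
  qed
  have "avg A (\<lambda>a. \<Sum>i\<in>I. ?g i a) = (\<Sum>i\<in>I. avg A (?g i))"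
    unfolding avg_def sum_divide_distrib[symmetric] by (subst sum.swap) simp
  also have "\<dots> \<le> (\<Sum>i\<in>I. w i * (25 / 18))" by (rule sum_mono) (rule one)
  also have "\<dots> \<le> real (card I) * (25 / 18) ^ Suc M"
  proof -
    have "(\<Sum>i\<in>I. w i * (25 / 18)) = (\<Sum>i\<in>I. w i) * (25 / 18)" by (rule sum_distrib_right[symmetric])
    also have "\<dots> \<le> real (card I) * (25 / 18) ^ M * (25 / 18)"
      using f(2) by (intro mult_right_mono) (simp_all only: w_def)
    finally show ?thesis by simp
  qed
  finally have *: "avg A (\<lambda>a. \<Sum>i\<in>I. ?g i a) \<le> real (card I) * (25 / 18) ^ Suc M" .
  have "\<exists>a\<in>A. (\<Sum>i\<in>I. ?g i a) \<le> real (card I) * (25 / 18) ^ Suc M"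
  proof (rule ccontr)
    assume "\<not> ?thesis"
    then have "(\<Sum>a\<in>A. real (card I) * (25 / 18) ^ Suc M) < (\<Sum>a\<in>A. \<Sum>i\<in>I. ?g i a)"
      by (intro sum_strict_mono A) (auto simp: not_le)
    then show False using * cA by (simp add: avg_def field_simps)
  qed
  then obtain a where a: "a \<in> A" "(\<Sum>i\<in>I. ?g i a) \<le> real (card I) * (25 / 18) ^ Suc M" by blast
  have "8 ^ card {m. m < Suc M \<and> bad i ((f(M := a)) m)} = ?g i a" for i
  proof -
    have "{m. m < Suc M \<and> bad i ((f(M := a)) m)} =
        (if bad i a then insert M {m. m < M \<and> bad i (f m)} else {m. m < M \<and> bad i (f m)})"
      by (auto simp: less_Suc_eq)
    then show ?thesis by (simp add: w_def)
  qed
  then show ?case using a f(1) by (intro exI[of _ "f(M := a)"]) (auto simp: less_Suc_eq)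
qed

definition miss :: "nat \<Rightarrow> (nat \<times> nat) set \<Rightarrow> nat \<Rightarrow> nat \<Rightarrow> tree list \<Rightarrow> bool" where
  "miss S E s t F \<longleftrightarrow> (\<forall>T\<in>set F. \<not> den S E T (\<lambda>_. s) (\<lambda>_. t) (\<lambda>x. x = 0) 0)"

lemma miss_sound: "(s, t) \<notin> E\<^sup>* \<Longrightarrow> miss S E s t F"
  unfolding miss_def using den_sound by fastforce

text \<open>An average of \<open>chi\<close> of at most 1/4 means that a tree fails with probability
  at most 5/8. Eight independent trees all fail with probability at most (5/8)^8 < 1/18.\<close>

lemma (in sampling) miss_fraction_forests:
  assumes E: "E \<subseteq> {..<n} \<times> {..<n}" "\<And>v. v < n \<Longrightarrow> (v, v) \<in> E" "s < n" "(s, t) \<in> E\<^sup>*"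
    and j: "j \<le> \<kappa>" "n \<le> range_len \<kappa> j" and S: "0 < S"
  shows "18 * card {F \<in> forests 8 (trees n S N j). miss S E s t F} \<le> card (forests 8 (trees n S N j))"
proof -
  let ?A = "trees n S N j"
  let ?d = "\<lambda>T. den S E T (\<lambda>_. s) (\<lambda>_. t) (\<lambda>x. x = 0) 0"
  define B where "B = {T \<in> ?A. \<not> ?d T}"
  have fin: "finite ?A" "?A \<noteq> {}" by (rule trees_finite, rule trees_nonempty[OF n])
  have finB: "finite B" using fin by (simp add: B_def)
  have B: "B \<subseteq> ?A" by (auto simp: B_def)
  have "{F \<in> forests 8 ?A. miss S E s t F} = {F. set F \<subseteq> B \<and> length F = 8}"
    by (auto simp: forests_def miss_def B_def)
  then have card: "card {F \<in> forests 8 ?A. miss S E s t F} = card B ^ 8"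
    using card_lists_length_eq[OF finB] by simp
  have cA: "0 < card ?A" using fin by (simp add: card_gt_0_iff)
  have "(s, t) \<in> reach E (range_len \<kappa> j)" by (rule rtrancl_reach[OF E(1,3,4) j(2)])
  then have "avg ?A (\<lambda>T. chi (?d T)) \<le> 1 / 4"
    using bias_le[OF E(1,2) j(1), of 0 "\<lambda>x. x = 0" "\<lambda>_. s" "\<lambda>_. t"] S E(3) by simp
  moreover have "avg ?A (\<lambda>T. chi (?d T)) = avg ?A (\<lambda>T. - 1 + (if \<not> ?d T then 2 else 0))"
    by (rule avg_cong) (simp add: chi_def)
  moreover have "\<dots> = - 1 + 2 * card B / card ?A"
    unfolding avg_add using avg_const[OF fin] avg_if[OF fin(1), of "\<lambda>T. \<not> ?d T" 2 0]
    by (simp only: B_def) simp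
  ultimately have "2 * real (card B) / card ?A \<le> 5 / 4" by linarith
  then have "8 * real (card B) \<le> 5 * card ?A" using cA by (simp add: field_simps)
  then have "8 * card B \<le> 5 * card ?A" by linarith
  then have "(8 * card B) ^ 8 \<le> (5 * card ?A) ^ 8" by (rule power_mono) simp
  then have "18 * card B ^ 8 \<le> card ?A ^ 8" unfolding power_mult_distrib by simp
  then show ?thesis
    using card card_lists_length_eq[OF fin(1), of 8] by (simp add: forests_def)
qed

text \<open>With H = 4 * 4^k there are at most 2^(n^2 + 2 n) <= 2^H inputs. After M = 2 H choices
  the total weight is at most 2^H * (25/18)^M <= 2^M, because (25/18)^2 < 2. An input with more than
  M/3 bad seeds would alone weigh more than 8^(M/3) = 2^M.\<close>

lemma (in sampling) good_seeds:
  assumes j: "j \<le> \<kappa>" "n \<le> range_len \<kappa> j" and S: "0 < S" and k: "n \<le> 2 ^ k"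
  shows "\<exists>f. (\<forall>\<sigma><(2::nat) ^ (2 * k + 3). f \<sigma> \<in> forests 8 (trees n S N j)) \<and>
    (\<forall>E s t. E \<subseteq> {..<n} \<times> {..<n} \<longrightarrow> (\<forall>v<n. (v, v) \<in> E) \<longrightarrow> s < n \<longrightarrow> t < n \<longrightarrow> (s, t) \<in> E\<^sup>* \<longrightarrow>
       3 * card {\<sigma>. \<sigma> < 2 ^ (2 * k + 3) \<and> miss S E s t (f \<sigma>)} \<le> 2 ^ (2 * k + 3))"
proof -
  define I where "I = {(E, s, t). E \<subseteq> {..<n} \<times> {..<n} \<and> (\<forall>v<n. (v, v) \<in> E) \<and> s < n \<and> t < n \<and>
    (s, t) \<in> E\<^sup>*}"
  define M where "M = (2::nat) ^ (2 * k + 3)"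
  define H where "H = 4 * ((2::nat) ^ k)\<^sup>2"
  have M: "M = 2 * H"
    by (simp add: M_def H_def power_add power_mult power2_eq_square mult.commute flip: power_mult_distrib)
  let ?J = "Pow ({..<n} \<times> {..<n}) \<times> {..<n} \<times> {..<n}"
  have "I \<subseteq> ?J" by (auto simp: I_def)
  moreover have "finite ?J" by simp
  ultimately have I: "finite I" "card I \<le> card ?J"
    by (metis finite_subset, metis card_mono)
  have "card ?J = 2 ^ (n * n) * (n * n)"
    by (simp add: card_cartesian_product card_Pow)
  also have "\<dots> \<le> 2 ^ (n * n) * (2 ^ n * 2 ^ n)"
    by (intro mult_mono le_refl) (auto intro: less_imp_le)
  also have "\<dots> = 2 ^ (n * n + 2 * n)" by (simp add: power_add mult_2)
  also have "\<dots> \<le> 2 ^ H"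
  proof (rule power_increasing)
    have "n\<^sup>2 \<le> (2 ^ k)\<^sup>2" using k by (rule power_mono) simp
    moreover have "n \<le> n * n" by simp
    ultimately show "n * n + 2 * n \<le> H" unfolding H_def power2_eq_square by linarith
  qed simp
  finally have cI: "card I \<le> 2 ^ H" using I(2) by simp
  let ?F = "forests 8 (trees n S N j)"
  have F: "finite ?F"
    unfolding forests_def by (rule finite_lists_length_eq[OF trees_finite])
  have F0: "?F \<noteq> {}"
  proof -
    obtain T where "T \<in> trees n S N j" using trees_nonempty[OF n] by blast
    then have "replicate 8 T \<in> ?F" by (auto simp: forests_def)
    then show ?thesis by blast
  qed
  have bad: "18 * card {F \<in> ?F. case i of (E, s, t) \<Rightarrow> miss S E s t F} \<le> card ?F" if "i \<in> I" for i
  proof -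
    obtain E s t where i: "i = (E, s, t)" by (cases i)
    then have "E \<subseteq> {..<n} \<times> {..<n}" "\<And>v. v < n \<Longrightarrow> (v, v) \<in> E" "s < n" "(s, t) \<in> E\<^sup>*"
      using that by (auto simp: I_def)
    from miss_fraction_forests[OF this j S] show ?thesis by (simp add: i)
  qed
  obtain f where f: "\<forall>m<M. f m \<in> ?F"
    and le: "(\<Sum>i\<in>I. 8 ^ card {m. m < M \<and> (case i of (E, s, t) \<Rightarrow> miss S E s t (f m))}) \<le>
      real (card I) * (25 / 18) ^ M"
    using newman[of ?F I "\<lambda>i F. case i of (E, s, t) \<Rightarrow> miss S E s t F" M, OF F F0 I(1) bad] by blast
  have "3 * card {m. m < M \<and> miss S E s t (f m)} \<le> M" if "(E, s, t) \<in> I" for E s t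
  proof (rule ccontr)
    let ?b = "card {m. m < M \<and> miss S E s t (f m)}"
    assume "\<not> 3 * ?b \<le> M"
    then have "(2::real) ^ M < 2 ^ (3 * ?b)" by (intro power_strict_increasing) auto
    also have "\<dots> = 8 ^ ?b" by (simp add: power_mult)
    also have "\<dots> \<le> (\<Sum>i\<in>I. 8 ^ card {m. m < M \<and> (case i of (E, s, t) \<Rightarrow> miss S E s t (f m))})"
      using member_le_sum[OF that, of "\<lambda>i. (8::real) ^ card {m. m < M \<and> (case i of (E, s, t) \<Rightarrow> miss S E s t (f m))}"] I
      by simp
    also note le
    also have "real (card I) * (25 / 18) ^ M \<le> 2 ^ H * 2 ^ H"
    proof (rule mult_mono)
      show "real (card I) \<le> 2 ^ H" using of_nat_mono[OF cI, where 'a = real] by simp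
      have "(25 / 18 :: real) ^ M = ((25 / 18)\<^sup>2) ^ H" by (simp add: M power_mult)
      also have "\<dots> \<le> 2 ^ H" by (rule power_mono) (simp_all add: power2_eq_square)
      finally show "(25 / 18 :: real) ^ M \<le> 2 ^ H" .
    qed auto
    also have "\<dots> = 2 ^ M" by (simp add: M mult_2 power_add)
    finally show False by simp
  qed
  then show ?thesis
    using f by (intro exI[of _ f]) (auto simp: I_def M_def)
qed

section \<open>Classical reversible computation\<close>

lemma bit_reg: "bit (reg qs c) i \<longleftrightarrow> i < length qs \<and> bit c (qs ! i)"
  by (auto simp: reg_def bit_horner_sum_bit_iff)

lemma reg_eq_iff: "reg qs c = reg qs c' \<longleftrightarrow> (\<forall>q\<in>set qs. bit c q = bit c' q)"
  by (auto simp: bit_eq_iff bit_reg all_set_conv_all_nth)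

lemma nat_less_two_power_iff: "c < 2 ^ m \<longleftrightarrow> (\<forall>q\<ge>m. \<not> bit c q)" for c :: nat
proof
  assume "c < 2 ^ m"
  then have "take_bit m c = c" by (simp add: take_bit_nat_eq_self_iff)
  then show "\<forall>q\<ge>m. \<not> bit c q" by (metis bit_take_bit_iff not_le)
next
  assume *: "\<forall>q\<ge>m. \<not> bit c q"
  have "take_bit m c = c"
    by (rule bit_eqI) (use * in \<open>auto simp: bit_take_bit_iff not_less[symmetric]\<close>)
  then show "c < 2 ^ m" by (simp add: take_bit_nat_eq_self_iff)
qed

lemma reg_less: "reg qs c < 2 ^ length qs"
  by (simp add: nat_less_two_power_iff bit_reg)

lemma bit_flip: "bit (flip_bit y c) q = (if q = y then \<not> bit c q else bit c q)" for c :: nat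
  by (auto simp: bit_flip_bit_iff)

lemma flip_flip: "flip_bit y (flip_bit y c) = c" for c :: nat
  by (rule bit_eqI) (simp add: bit_flip)

lemma flip_less: "y < m \<Longrightarrow> flip_bit y c < 2 ^ m \<longleftrightarrow> c < 2 ^ m" for c :: nat
  by (auto simp: nat_less_two_power_iff bit_flip)

lemma flip_neq: "flip_bit y c \<noteq> c" for c :: nat
  using bit_flip[of y c y] by metis

lemma agree_off_iff:
  fixes r c :: nat
  assumes "r < 2 ^ m" "c < 2 ^ m"
  shows "(\<forall>q<m. q \<noteq> y \<longrightarrow> bit r q = bit c q) \<longleftrightarrow> r = c \<or> r = flip_bit y c"
proof
  assume *: "\<forall>q<m. q \<noteq> y \<longrightarrow> bit r q = bit c q"
  have "bit r q = bit c q" if "q \<noteq> y" for q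
    using * assms that by (cases "q < m") (auto simp: nat_less_two_power_iff)
  then have "r = (if bit r y = bit c y then c else flip_bit y c)"
    by (intro bit_eqI) (auto simp: bit_flip)
  then show "r = c \<or> r = flip_bit y c" by presburger
qed (auto simp: bit_flip)

lemma gate_mat_entry:
  assumes "r < 2 ^ m" "c < 2 ^ m"
  shows "gate_mat m [y] U $$ (r, c) =
    (if r = c \<or> r = flip_bit y c then U $$ (of_bool (bit r y), of_bool (bit c y)) else 0)"
proof -
  have "reg [y] d = of_bool (bit d y)" for d by (simp add: reg_def)
  moreover have "(\<forall>q<m. q \<notin> set [y] \<longrightarrow> bit r q = bit c q) \<longleftrightarrow> r = c \<or> r = flip_bit y c"
    using agree_off_iff[OF assms] by simp
  ultimately show ?thesis unfolding gate_mat_def using assms by simp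
qed

definition xmat :: "complex mat" where
  "xmat = mat 2 2 (\<lambda>(i, j). if i = j then 0 else 1)"

definition hmat :: "complex mat" where
  "hmat = mat 2 2 (\<lambda>(i, j). (if i = 1 \<and> j = 1 then - 1 else 1) / complex_of_real (sqrt 2))"

lemma unitary_2I:
  assumes "U \<in> carrier_mat 2 2"
    and "\<And>i j. i < 2 \<Longrightarrow> j < 2 \<Longrightarrow>
      cnj (U $$ (0, i)) * U $$ (0, j) + cnj (U $$ (1, i)) * U $$ (1, j) = of_bool (i = j)"
  shows "unitary_mat U"
  unfolding unitary_mat_def
proof
  show "square_mat U" using assms(1) by auto
  show "mat_adjoint U * U = 1\<^sub>m (dim_row U)"
  proof (rule eq_matI)
    fix i j assume "i < dim_row (1\<^sub>m (dim_row U) :: complex mat)" "j < dim_col (1\<^sub>m (dim_row U) :: complex mat)"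
    then have ij: "i < 2" "j < 2" using assms(1) by auto
    have "(mat_adjoint U * U) $$ (i, j) = cnj (U $$ (0, i)) * U $$ (0, j) + cnj (U $$ (1, i)) * U $$ (1, j)"
      using ij assms(1) by (simp add: mat_adjoint_def mat_of_rows_def scalar_prod_def numeral_2_eq_2)
    then show "(mat_adjoint U * U) $$ (i, j) = 1\<^sub>m (dim_row U) $$ (i, j)"
      using assms ij by simp
  qed (use assms(1) in \<open>auto simp: mat_adjoint_def\<close>)
qed

lemma xmat_carrier: "xmat \<in> carrier_mat 2 2" and hmat_carrier: "hmat \<in> carrier_mat 2 2"
  by (simp_all add: xmat_def hmat_def)

lemma xmat_unitary: "unitary_mat xmat"
  by (rule unitary_2I) (auto simp: xmat_def less_2_cases_iff)

lemma hmat_unitary: "unitary_mat hmat"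
proof (rule unitary_2I)
  have s: "complex_of_real (sqrt 2) * complex_of_real (sqrt 2) = 2"
    by (simp flip: of_real_mult)
  show "cnj (hmat $$ (0, i)) * hmat $$ (0, j) + cnj (hmat $$ (1, i)) * hmat $$ (1, j) = of_bool (i = j)"
    if "i < 2" "j < 2" for i j
    using that s by (auto simp: hmat_def less_2_cases_iff)
qed (simp add: hmat_def)

lemma unit_cost_gate:
  assumes "unitary_mat U" "U \<in> carrier_mat 2 2" "y \<in> Q"
  shows "unit_cost k Q (Gate [y] U)"
  by (rule unit_cost.Gate) (use assms in auto)

text \<open>Equal positive amplitudes on a set of basis states. Every state of the algorithm has
  this form, so the analysis follows sets instead of vectors.\<close>

definition uni :: "nat \<Rightarrow> nat set \<Rightarrow> complex vec" where
  "uni m I = vec (2 ^ m) (\<lambda>i. if i \<in> I then complex_of_real (1 / sqrt (card I)) else 0)"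

lemma mult_uni:
  assumes "M \<in> carrier_mat (2 ^ m) (2 ^ m)" "I \<subseteq> {..<2 ^ m}" "r < 2 ^ m"
  shows "(M *\<^sub>v uni m I) $ r = (\<Sum>c\<in>I. M $$ (r, c)) * complex_of_real (1 / sqrt (card I))"
proof -
  have "(M *\<^sub>v uni m I) $ r =
      (\<Sum>c\<in>{0..<2 ^ m}. M $$ (r, c) * (if c \<in> I then complex_of_real (1 / sqrt (card I)) else 0))"
    using assms by (simp add: scalar_prod_def uni_def)
  also have "\<dots> = (\<Sum>c\<in>I. M $$ (r, c) * complex_of_real (1 / sqrt (card I)))"
    by (rule sum.mono_neutral_cong_right) (use assms(2) in auto)
  finally show ?thesis by (simp only: sum_distrib_right)
qed

text \<open>Only the columns of states with qubit \<open>en\<close> set are described: on the others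
  a compiled \<open>Select\<close> finds step number 0 and does not realise \<open>p\<close>.
  Injectivity of \<open>p\<close> ensures that images of sets keep their size.\<close>

definition acts :: "nat \<Rightarrow> nat \<Rightarrow> nat pair_pre_digraph \<Rightarrow> instr \<Rightarrow> (nat \<Rightarrow> nat) \<Rightarrow> bool" where
  "acts m en G I p \<longleftrightarrow> instr_mat m G I \<in> carrier_mat (2 ^ m) (2 ^ m) \<and> inj p \<and>
     (\<forall>c<2 ^ m. bit c en \<longrightarrow> p c < 2 ^ m \<and> bit (p c) en \<and>
       (\<forall>r<2 ^ m. instr_mat m G I $$ (r, c) = of_bool (r = p c)))"

lemma acts_uni:
  assumes "acts m en G J p" "\<And>c. c \<in> I \<Longrightarrow> c < 2 ^ m \<and> bit c en"
  shows "instr_mat m G J *\<^sub>v uni m I = uni m (p ` I)"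
proof (rule eq_vecI)
  fix r assume "r < dim_vec (uni m (p ` I))"
  then have r: "r < 2 ^ m" by (simp add: uni_def)
  have fin: "finite I" by (rule finite_subset[of _ "{..<2 ^ m}"]) (use assms(2) in auto)
  have inj: "inj_on p I" using assms(1) unfolding acts_def by (meson inj_on_subset subset_UNIV)
  have "(\<Sum>c\<in>I. instr_mat m G J $$ (r, c)) = (\<Sum>c\<in>I. of_bool (r = p c))"
    by (rule sum.cong) (use assms r in \<open>auto simp: acts_def\<close>)
  also have "\<dots> = (\<Sum>c\<in>p ` I. of_bool (r = c))"
    using inj by (simp add: sum.reindex)
  also have "\<dots> = of_bool (r \<in> p ` I)"
    using fin by (simp add: of_bool_def sum.delta)
  finally show "(instr_mat m G J *\<^sub>v uni m I) $ r = uni m (p ` I) $ r"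
    using r assms card_image[OF inj] by (subst mult_uni) (auto simp: acts_def uni_def)
qed (use assms in \<open>auto simp: acts_def uni_def\<close>)

section \<open>Controlled flips and queries as permutations of basis states\<close>

definition cflip :: "(nat \<Rightarrow> bool) \<Rightarrow> nat \<Rightarrow> nat \<Rightarrow> nat" where
  "cflip f y c = (if f c then flip_bit y c else c)"

lemma bit_cflip: "bit (cflip f y c) q = (if q = y \<and> f c then \<not> bit c q else bit c q)"
  by (auto simp: cflip_def bit_flip)

lemma inj_cflip: "(\<And>c. f (flip_bit y c) = f c) \<Longrightarrow> inj (cflip f y)"
  by (rule inj_on_inverseI[of _ "cflip f y"]) (auto simp: cflip_def flip_flip)

datatype cop = Flip "nat \<Rightarrow> bool" nat | Ask "nat list" "nat list" nat

primrec cop_fun :: "nat pair_pre_digraph \<Rightarrow> cop \<Rightarrow> nat \<Rightarrow> nat" where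
  "cop_fun G (Flip f y) = cflip f y"
| "cop_fun G (Ask us vs a) = cflip (\<lambda>c. (reg us c, reg vs c) \<in> parcs G) a"

text \<open>The index register of a compiled flip: with every qubit except the target and the step
  qubit in it, the table of subroutines can realise an arbitrary predicate of these qubits.\<close>

definition controls :: "nat \<Rightarrow> nat \<Rightarrow> nat \<Rightarrow> nat list" where
  "controls m en y = filter (\<lambda>q. q \<noteq> y \<and> q \<noteq> en) [0..<m]"

text \<open>The step register of the \<open>Select\<close> is the qubit \<open>en\<close>, which holds the step number 1.\<close>

primrec cop_instr :: "nat \<Rightarrow> nat \<Rightarrow> cop \<Rightarrow> instr" where
  "cop_instr m en (Flip f y) = Select (controls m en y) [en]
     (map (\<lambda>i. if \<exists>c<2 ^ m. bit c en \<and> reg (controls m en y) c = i \<and> f c then [Gate [y] xmat] else [])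
       [0..<2 ^ length (controls m en y)])"
| "cop_instr m en (Ask us vs a) = Query us vs a"

primrec cop_ok :: "nat \<Rightarrow> nat \<Rightarrow> nat \<Rightarrow> cop \<Rightarrow> bool" where
  "cop_ok k m en (Flip f y) \<longleftrightarrow> y < m \<and> en < m \<and> y \<noteq> en \<and> (\<forall>c. f (flip_bit y c) = f c)"
| "cop_ok k m en (Ask us vs a) \<longleftrightarrow> distinct (us @ vs @ [a]) \<and> set (us @ vs @ [a]) \<subseteq> {..<m} - {en} \<and>
     length us = k \<and> length vs = k"

lemma unit_cost_cop:
  assumes "cop_ok k m en I"
  shows "unit_cost k {..<m} (cop_instr m en I)"
proof (cases I)
  case (Flip f y)
  let ?cs = "controls m en y"
  show ?thesis unfolding Flip cop_instr.simps
  proof (rule unit_cost.Select)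
    show "distinct (?cs @ [en])" "set (?cs @ [en]) \<subseteq> {..<m}"
      using assms Flip by (auto simp: controls_def)
    fix T J assume T: "T \<in> set (map (\<lambda>i. if \<exists>c<2 ^ m. bit c en \<and> reg ?cs c = i \<and> f c then [Gate [y] xmat] else [])
       [0..<2 ^ length ?cs])"
    then show "length T < 2 ^ length [en]" by (auto split: if_splits)
    assume "J \<in> set T"
    then have "J = Gate [y] xmat" using T by (auto split: if_splits)
    then show "unit_cost k ({..<m} - set (?cs @ [en])) J"
      using assms Flip by (auto intro!: unit_cost_gate[OF xmat_unitary xmat_carrier] simp: controls_def)
  qed simp
next
  case (Ask us vs a)
  show ?thesis unfolding Ask cop_instr.simps
    by (rule unit_cost.Query) (use assms Ask in auto)
qed

lemma cop_acts:
  assumes ok: "cop_ok k m en I"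
  shows "acts m en G (cop_instr m en I) (cop_fun G I)"
proof (cases I)
  case (Flip f y)
  let ?cs = "controls m en y"
  have y: "y < m" "en < m" "y \<noteq> en" "\<And>c. f (flip_bit y c) = f c" using ok Flip by auto
  have set: "set ?cs = {..<m} - {y, en}" by (auto simp: controls_def)
  have en: "reg [en] c = of_bool (bit c en)" for c by (simp add: reg_def)
  have "instr_mat m G (cop_instr m en (Flip f y)) $$ (r, c) = of_bool (r = cflip f y c)"
    if r: "r < 2 ^ m" and c: "c < 2 ^ m" "bit c en" for r c
  proof -
    \<comment> \<open>The table entry quantifies over all states with the same index and
      \<open>en\<close> set; these agree with \<open>c\<close> except possibly in qubit
      \<open>y\<close>, on which \<open>f\<close> does not depend.\<close>
    have same: "(\<exists>c'<2 ^ m. bit c' en \<and> reg ?cs c' = reg ?cs c \<and> f c') \<longleftrightarrow> f c"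
    proof
      assume "\<exists>c'<2 ^ m. bit c' en \<and> reg ?cs c' = reg ?cs c \<and> f c'"
      then obtain c' where c': "c' < 2 ^ m" "bit c' en" "reg ?cs c' = reg ?cs c" "f c'" by blast
      then have "\<forall>q<m. q \<noteq> y \<longrightarrow> bit c' q = bit c q"
        using c unfolding reg_eq_iff set by auto
      then show "f c" using agree_off_iff[OF c'(1) c(1)] c'(4) y(4) by auto
    qed (use c in blast)
    have flip: "reg ?cs (flip_bit y c) = reg ?cs c" "bit (flip_bit y c) en"
      using c y by (auto simp: reg_eq_iff set bit_flip)
    have x: "gate_mat m [y] xmat $$ (r, c) = of_bool (r = flip_bit y c)"
      using r c by (auto simp: gate_mat_entry xmat_def bit_flip of_bool_def flip_neq flip_neq[symmetric])
    show ?thesis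
      using r c reg_less[of ?cs c] flip x same
      by (auto simp: select_mat_def Let_def en cflip_def)
  qed
  moreover have "instr_mat m G (cop_instr m en (Flip f y)) \<in> carrier_mat (2 ^ m) (2 ^ m)"
    by (simp add: select_mat_def)
  ultimately show ?thesis
    using y by (auto simp: acts_def Flip bit_cflip inj_cflip) (auto simp: cflip_def flip_less)
next
  case (Ask us vs a)
  have a: "a < m" "a \<noteq> en" "a \<notin> set us" "a \<notin> set vs" using ok Ask by auto
  have inv: "reg us (flip_bit a c) = reg us c" "reg vs (flip_bit a c) = reg vs c" for c
    using a by (auto simp: reg_eq_iff bit_flip)
  have "query_mat m G us vs a $$ (r, c) = of_bool (r = cflip (\<lambda>c. (reg us c, reg vs c) \<in> parcs G) a c)"
    if "r < 2 ^ m" "c < 2 ^ m" for r c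
    using that by (auto simp: query_mat_def cflip_def)
  then show ?thesis
    using a inv by (auto simp: acts_def Ask bit_cflip inj_cflip query_mat_def)
      (auto simp: cflip_def flip_less)
qed

lemma fold_acts_uni:
  assumes "\<forall>I\<in>set Is. cop_ok k m en I" "\<And>c. c \<in> A \<Longrightarrow> c < 2 ^ m \<and> bit c en"
  shows "fold (\<lambda>I v. instr_mat m G I *\<^sub>v v) (map (cop_instr m en) Is) (uni m A) =
    uni m (fold (cop_fun G) Is ` A)" and "inj (fold (cop_fun G) Is)"
    and "\<And>c. c \<in> A \<Longrightarrow> fold (cop_fun G) Is c < 2 ^ m"
proof -
  have "fold (\<lambda>I v. instr_mat m G I *\<^sub>v v) (map (cop_instr m en) Is) (uni m A) =
    uni m (fold (cop_fun G) Is ` A) \<and> inj (fold (cop_fun G) Is) \<and>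
    (\<forall>c\<in>A. fold (cop_fun G) Is c < 2 ^ m)"
    using assms
  proof (induction Is arbitrary: A)
    case (Cons I Is)
    have acts: "acts m en G (cop_instr m en I) (cop_fun G I)"
      using Cons.prems(1) by (auto intro: cop_acts)
    have step: "instr_mat m G (cop_instr m en I) *\<^sub>v uni m A = uni m (cop_fun G I ` A)"
      using acts Cons.prems(2) by (rule acts_uni)
    have "c < 2 ^ m \<and> bit c en" if "c \<in> cop_fun G I ` A" for c
      using that acts Cons.prems(2) by (auto simp: acts_def)
    with Cons.IH[of "cop_fun G I ` A"] Cons.prems(1) step acts show ?case
      by (auto simp: image_comp acts_def intro: inj_compose[unfolded o_def])
  qed simp
  then show "fold (\<lambda>I v. instr_mat m G I *\<^sub>v v) (map (cop_instr m en) Is) (uni m A) =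
    uni m (fold (cop_fun G) Is ` A)" "inj (fold (cop_fun G) Is)"
    "\<And>c. c \<in> A \<Longrightarrow> fold (cop_fun G) Is c < 2 ^ m" by auto
qed

section \<open>Preparing the superposition of seeds\<close>

lemma xgate_uni:
  assumes "y < m" "c < 2 ^ m"
  shows "instr_mat m G (Gate [y] xmat) *\<^sub>v uni m {c} = uni m {flip_bit y c}"
proof (rule eq_vecI)
  fix r assume "r < dim_vec (uni m {flip_bit y c})"
  then have r: "r < 2 ^ m" by (simp add: uni_def)
  have "gate_mat m [y] xmat $$ (r, c) = of_bool (r = flip_bit y c)"
    using r assms by (auto simp: gate_mat_entry xmat_def bit_flip of_bool_def flip_neq flip_neq[symmetric])
  then show "(instr_mat m G (Gate [y] xmat) *\<^sub>v uni m {c}) $ r = uni m {flip_bit y c} $ r"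
    using r assms by (subst mult_uni) (auto simp: gate_mat_def uni_def)
qed (simp add: uni_def gate_mat_def)

text \<open>Qubit \<open>y\<close> is 0 in all of \<open>A\<close>, so only the positive first
  column of \<open>hmat\<close> enters, and \<open>A\<close> and its flipped copy are disjoint: the
  set doubles without interference.\<close>

lemma hgate_uni:
  assumes y: "y < m" and A: "\<And>c. c \<in> A \<Longrightarrow> c < 2 ^ m \<and> \<not> bit c y"
  shows "instr_mat m G (Gate [y] hmat) *\<^sub>v uni m A = uni m (A \<union> flip_bit y ` A)"
proof (rule eq_vecI)
  fix r assume "r < dim_vec (uni m (A \<union> flip_bit y ` A))"
  then have r: "r < 2 ^ m" by (simp add: uni_def)
  have fin: "finite A" by (rule finite_subset[of _ "{..<2 ^ m}"]) (use A in auto)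
  \<comment> \<open>The only candidate for a preimage of \<open>r\<close> in \<open>A\<close>, found
    by clearing qubit \<open>y\<close>.\<close>
  define r0 where "r0 = (if bit r y then flip_bit y r else r)"
  have entry: "gate_mat m [y] hmat $$ (r, c) = (if c = r0 then 1 / complex_of_real (sqrt 2) else 0)"
    if "c \<in> A" for c
  proof -
    have "r = c \<or> r = flip_bit y c \<longleftrightarrow> c = r0"
      using A[OF that] unfolding r0_def by (metis bit_flip flip_flip)
    then show ?thesis
      using A[OF that] r by (auto simp: gate_mat_entry hmat_def)
  qed
  have mem: "r \<in> flip_bit y ` A \<longleftrightarrow> flip_bit y r \<in> A"
    using flip_flip[of y] by (metis imageE imageI)
  have in_iff: "r \<in> A \<union> flip_bit y ` A \<longleftrightarrow> r0 \<in> A"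
  proof (cases "bit r y")
    case True
    then have "r \<notin> A" using A by blast
    then show ?thesis using True mem by (simp add: r0_def)
  next
    case False
    then have "bit (flip_bit y r) y" by (simp add: bit_flip)
    then have "flip_bit y r \<notin> A" using A by blast
    then show ?thesis using False mem by (simp add: r0_def)
  qed
  have "flip_bit y d \<notin> A" if "d \<in> A" for d
  proof -
    have "bit (flip_bit y d) y" using A[OF that] by (simp add: bit_flip)
    then show ?thesis using A by blast
  qed
  then have "A \<inter> flip_bit y ` A = {}" by blast
  moreover have "inj_on (flip_bit y) A" by (rule inj_on_inverseI) (rule flip_flip)
  ultimately have card: "card (A \<union> flip_bit y ` A) = 2 * card A"
    using fin by (simp add: card_Un_disjoint card_image)
  have "(\<Sum>c\<in>A. gate_mat m [y] hmat $$ (r, c)) = (\<Sum>c\<in>A. if c = r0 then 1 / complex_of_real (sqrt 2) else 0)"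
    by (rule sum.cong) (use entry in auto)
  also have "\<dots> = (if r0 \<in> A then 1 / complex_of_real (sqrt 2) else 0)"
    using fin by simp
  finally show "(instr_mat m G (Gate [y] hmat) *\<^sub>v uni m A) $ r = uni m (A \<union> flip_bit y ` A) $ r"
    using r A in_iff
    by (subst mult_uni) (auto simp: gate_mat_def uni_def card real_sqrt_mult)
qed (simp add: uni_def gate_mat_def)

lemma hadamards_uni:
  assumes "a + \<mu> \<le> m" "c < 2 ^ m" "\<And>q. a \<le> q \<Longrightarrow> q < a + \<mu> \<Longrightarrow> \<not> bit c q"
  shows "fold (\<lambda>I v. instr_mat m G I *\<^sub>v v) (map (\<lambda>q. Gate [q] hmat) [a..<a + \<mu>]) (uni m {c}) =
    uni m ((\<lambda>\<sigma>. xor c (push_bit a \<sigma>)) ` {..<2 ^ \<mu>})"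
  using assms
proof (induction \<mu>)
  case (Suc \<mu>)
  let ?g = "\<lambda>\<sigma>. xor c (push_bit a \<sigma>)"
  have IH: "fold (\<lambda>I v. instr_mat m G I *\<^sub>v v) (map (\<lambda>q. Gate [q] hmat) [a..<a + \<mu>]) (uni m {c}) =
    uni m (?g ` {..<2 ^ \<mu>})"
    using Suc by simp
  have g: "?g \<sigma> < 2 ^ m" "\<not> bit (?g \<sigma>) (a + \<mu>)" if "\<sigma> < 2 ^ \<mu>" for \<sigma>
    using that Suc.prems by (auto simp: nat_less_two_power_iff bit_simps)
  have flip: "flip_bit (a + \<mu>) (?g \<sigma>) = ?g (flip_bit \<mu> \<sigma>)" for \<sigma>
    by (rule bit_eqI) (auto simp: bit_simps)
  have split: "{..<2 ^ Suc \<mu>} = {..<2 ^ \<mu>} \<union> flip_bit \<mu> ` {..<2 ^ \<mu> :: nat}"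
  proof (rule Set.set_eqI, rule iffI)
    fix \<sigma> :: nat assume \<sigma>: "\<sigma> \<in> {..<2 ^ Suc \<mu>}"
    then have hi: "\<forall>q\<ge>Suc \<mu>. \<not> bit \<sigma> q"
      unfolding lessThan_iff nat_less_two_power_iff .
    have "(if bit \<sigma> \<mu> then flip_bit \<mu> \<sigma> else \<sigma>) < 2 ^ \<mu>"
      unfolding nat_less_two_power_iff
    proof (intro allI impI)
      fix q assume "\<mu> \<le> q"
      then show "\<not> bit (if bit \<sigma> \<mu> then flip_bit \<mu> \<sigma> else \<sigma>) q"
        using hi by (cases "q = \<mu>") (auto simp: bit_flip)
    qed
    then show "\<sigma> \<in> {..<2 ^ \<mu>} \<union> flip_bit \<mu> ` {..<2 ^ \<mu>}"
      by (metis UnI1 UnI2 flip_flip imageI lessThan_iff)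
  next
    fix \<sigma> :: nat assume "\<sigma> \<in> {..<2 ^ \<mu>} \<union> flip_bit \<mu> ` {..<2 ^ \<mu>}"
    then show "\<sigma> \<in> {..<2 ^ Suc \<mu>}"
      unfolding lessThan_def nat_less_two_power_iff by (auto simp: bit_flip)
  qed
  have "instr_mat m G (Gate [a + \<mu>] hmat) *\<^sub>v uni m (?g ` {..<2 ^ \<mu>}) =
      uni m (?g ` {..<2 ^ \<mu>} \<union> flip_bit (a + \<mu>) ` ?g ` {..<2 ^ \<mu>})"
    by (rule hgate_uni) (use Suc.prems g in auto)
  also have "?g ` {..<2 ^ \<mu>} \<union> flip_bit (a + \<mu>) ` ?g ` {..<2 ^ \<mu>} = ?g ` {..<2 ^ Suc \<mu>}"
    unfolding split image_Un image_image flip ..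
  finally show ?case using IH by simp
qed (simp add: lessThan_Suc)

section \<open>Straight-line programs\<close>

text \<open>Bits are addressed as (register, slot). The arc is a function of the input pair because
  the end classes of a root tree consist of copies of \<open>s\<close> and \<open>t\<close>, while
  midpoints are constants.\<close>

datatype op = Op (src_bit: "nat \<times> nat") (dst_bit: "nat \<times> nat")
  (arc_from: "nat \<times> nat \<Rightarrow> nat") (arc_to: "nat \<times> nat \<Rightarrow> nat") (coin: bool)

definition exec :: "(nat \<times> nat) set \<Rightarrow> nat \<times> nat \<Rightarrow> op \<Rightarrow> (nat \<times> nat \<Rightarrow> bool) \<Rightarrow> nat \<times> nat \<Rightarrow> bool" where
  "exec E st a f = (if coin a \<and> f (src_bit a) \<and> (arc_from a st, arc_to a st) \<in> E
     then f(dst_bit a := \<not> f (dst_bit a)) else f)"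

text \<open>The second call of \<open>l\<close> clears the workspace register \<open>z\<close> again.\<close>

primrec compile :: "nat \<Rightarrow> tree \<Rightarrow> nat \<Rightarrow> nat \<Rightarrow>
    (nat \<Rightarrow> nat \<times> nat \<Rightarrow> nat) \<Rightarrow> (nat \<Rightarrow> nat \<times> nat \<Rightarrow> nat) \<Rightarrow> op list" where
  "compile S (Leaf c) X Y U V =
     concat (map (\<lambda>y. map (\<lambda>x. Op (X, x) (Y, y) (U x) (V y) (c ! x)) [0..<S]) [0..<S])"
| "compile S (Node z M l r q) X Y U V =
     compile S l X z U (\<lambda>i _. M ! i) @ compile S r z Y (\<lambda>i _. M ! i) V @
     compile S l X z U (\<lambda>i _. M ! i) @ compile S q X Y U V"

primrec wf_tree :: "nat \<Rightarrow> nat \<Rightarrow> tree \<Rightarrow> nat \<Rightarrow> bool" where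
  "wf_tree n S (Leaf c) j \<longleftrightarrow> True"
| "wf_tree n S (Node z M l r q) j \<longleftrightarrow>
     z < j \<and> M \<in> vlists n S \<and> wf_tree n S l z \<and> wf_tree n S r z \<and> wf_tree n S q j"

lemma wf_tree_mono: "wf_tree n S T i \<Longrightarrow> i \<le> j \<Longrightarrow> wf_tree n S T j"
  by (induction T arbitrary: i j) auto

lemma midsE:
  assumes "T \<in> mids n S z A Q"
  obtains M l r q where "T = Node z M l r q" "M \<in> vlists n S" "l \<in> A" "r \<in> A" "q \<in> Q"
  using assms unfolding mids_def by auto

lemma trees_wf: "T \<in> trees n S N j \<Longrightarrow> wf_tree n S T j"
proof (induction j arbitrary: T)
  case (Suc j)
  from Suc.prems show ?case
  proof (rule trees_Suc_induct)
    show "wf_tree n S T (Suc j)" if "T \<in> trees n S N j" for T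
      using Suc.IH[OF that] by (rule wf_tree_mono) simp
  qed (use Suc.IH in simp)
qed auto

lemma odd_card_Suc: "odd (card {x. x < Suc l \<and> P x}) = (odd (card {x. x < l \<and> P x}) \<noteq> P l)"
proof -
  have "{x. x < Suc l \<and> P x} = (if P l then insert l {x. x < l \<and> P x} else {x. x < l \<and> P x})"
    by (auto simp: less_Suc_eq)
  then show ?thesis by simp
qed

lemma exec_row:
  assumes "X \<noteq> Y"
  shows "fold (exec E st) (map (\<lambda>x. Op (X, x) (Y, y) (U x) (V y) (c ! x)) [0..<l]) f =
    (if odd (card {x. x < l \<and> c ! x \<and> f (X, x) \<and> (U x st, V y st) \<in> E})
     then f((Y, y) := \<not> f (Y, y)) else f)"
proof (induction l)
  case (Suc l)
  have step: "fold (exec E st) (map (\<lambda>x. Op (X, x) (Y, y) (U x) (V y) (c ! x)) [0..<Suc l]) f =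
    exec E st (Op (X, l) (Y, y) (U l) (V y) (c ! l))
      (fold (exec E st) (map (\<lambda>x. Op (X, x) (Y, y) (U x) (V y) (c ! x)) [0..<l]) f)"
    by simp
  show ?case
    unfolding step Suc.IH odd_card_Suc using assms by (auto simp: exec_def fun_eq_iff)
qed simp

lemma exec_leaf:
  assumes "X \<noteq> Y"
  shows "fold (exec E st)
      (concat (map (\<lambda>y. map (\<lambda>x. Op (X, x) (Y, y) (U x) (V y) (c ! x)) [0..<S]) [0..<l])) f =
    (\<lambda>(r, y). if r = Y \<and> y < l \<and>
      odd (card {x. x < S \<and> c ! x \<and> f (X, x) \<and> (U x st, V y st) \<in> E}) then \<not> f (r, y) else f (r, y))"
proof (induction l)
  case (Suc l)
  show ?case
    using assms by (auto simp: Suc.IH exec_row fun_eq_iff less_Suc_eq)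
qed auto

lemma exec_compile:
  assumes "wf_tree n S T j" "j \<le> X" "j \<le> Y" "X \<noteq> Y" "\<And>z x. z < j \<Longrightarrow> x < S \<Longrightarrow> \<not> f (z, x)"
  shows "fold (exec E st) (compile S T X Y U V) f =
    (\<lambda>(r, y). if r = Y \<and> y < S \<and>
      den S E T (\<lambda>x. U x st) (\<lambda>y. V y st) (\<lambda>x. f (X, x)) y then \<not> f (r, y) else f (r, y))"
  using assms
proof (induction T arbitrary: j X Y U V f)
  case (Leaf c)
  then show ?case by (simp add: exec_leaf)
next
  case (Node z M l r q)
  let ?m = "\<lambda>i _ :: nat \<times> nat. M ! i"
  let ?u = "\<lambda>x. U x st" and ?v = "\<lambda>y. V y st"
  let ?L = "fold (exec E st) (compile S l X z U ?m)"
  let ?dl = "den S E l ?u ((!) M) (\<lambda>x. f (X, x))"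
  let ?dr = "den S E r ((!) M) ?v ?dl"
  let ?dq = "den S E q ?u ?v (\<lambda>x. f (X, x))"
  have z: "z < j" "z \<noteq> X" "z \<noteq> Y" "z \<le> X" "z \<le> Y" using Node.prems by auto
  have wf: "wf_tree n S l z" "wf_tree n S r z" "wf_tree n S q j" using Node.prems by auto
  define f1 where "f1 = ?L f"
  have f1: "f1 = (\<lambda>(a, b). if a = z \<and> b < S \<and> ?dl b then \<not> f (a, b) else f (a, b))"
    unfolding f1_def using Node.IH(1)[OF wf(1), of X z f U ?m] z Node.prems by simp
  define f2 where "f2 = fold (exec E st) (compile S r z Y ?m V) f1"
  have dr: "den S E r ((!) M) ?v (\<lambda>x. f1 (z, x)) y = ?dr y" for y
    by (rule den_cong) (use z Node.prems in \<open>auto simp: f1\<close>)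
  have f2: "f2 = (\<lambda>(a, b). if a = Y \<and> b < S \<and> ?dr b then \<not> f1 (a, b) else f1 (a, b))"
    unfolding f2_def using Node.IH(2)[OF wf(2), of z Y f1 ?m V] z Node.prems dr by (simp add: f1)
  have X2: "(\<lambda>x. f2 (X, x)) = (\<lambda>x. f (X, x))"
    using z Node.prems by (auto simp: f1 f2)
  have w2: "\<not> f2 (a, b)" if "a < z" "b < S" for a b
    using that z Node.prems by (auto simp: f1 f2)
  \<comment> \<open>The induction hypothesis asks for clean registers below \<open>z\<close>, not
    for a clean target, so the same bitmap is added to \<open>z\<close> once more and
    cancels.\<close>
  define f3 where "f3 = ?L f2"
  have f3': "f3 = (\<lambda>(a, b). if a = z \<and> b < S \<and> ?dl b then \<not> f2 (a, b) else f2 (a, b))"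
    unfolding f3_def using Node.IH(1)[OF wf(1), of X z f2 U ?m] z Node.prems w2 X2 by simp
  have f3: "f3 = (\<lambda>(a, b). if a = Y \<and> b < S \<and> ?dr b then \<not> f (a, b) else f (a, b))"
    unfolding f3' f2 f1 using z by (auto simp: fun_eq_iff)
  have X3: "(\<lambda>x. f3 (X, x)) = (\<lambda>x. f (X, x))"
    using Node.prems by (auto simp: f3)
  have w3: "\<not> f3 (a, b)" if "a < j" "b < S" for a b
    using that Node.prems by (auto simp: f3)
  have "fold (exec E st) (compile S q X Y U V) f3 =
      (\<lambda>(a, b). if a = Y \<and> b < S \<and> ?dq b then \<not> f3 (a, b) else f3 (a, b))"
    using Node.IH(3)[OF wf(3), of X Y f3 U V] Node.prems w3 X3 by simp
  also have "\<dots> = (\<lambda>(a, b). if a = Y \<and> b < S \<and> (?dr b \<noteq> ?dq b) then \<not> f (a, b) else f (a, b))"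
    unfolding f3 by (auto simp: fun_eq_iff)
  finally show ?case by (simp add: f1_def f2_def f3_def)
qed

text \<open>Addresses and vertex names fit into the layout, and source and target lie in different
  registers, so that an operation never flips its own control.\<close>

lemma compile_ops:
  assumes "wf_tree n S T j" "j \<le> X" "j \<le> Y" "X \<noteq> Y" "n \<le> B"
    and "\<And>x. x < S \<Longrightarrow> U x st < B" "\<And>y. y < S \<Longrightarrow> V y st < B"
    and "a \<in> set (compile S T X Y U V)"
  shows "fst (src_bit a) \<in> insert X {..<j} \<and> snd (src_bit a) < S \<and>
    fst (dst_bit a) \<in> insert Y {..<j} \<and> snd (dst_bit a) < S \<and> fst (src_bit a) \<noteq> fst (dst_bit a) \<and>
    arc_from a st < B \<and> arc_to a st < B"
  using assms
proof (induction T arbitrary: j X Y U V)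
  case (Leaf c)
  then show ?case by auto
next
  case (Node z M l r q)
  let ?m = "\<lambda>i _ :: nat \<times> nat. M ! i"
  have z: "z < j" "z \<noteq> X" "z \<noteq> Y" "z \<le> X" "z \<le> Y" using Node.prems by auto
  have wf: "wf_tree n S l z" "wf_tree n S r z" "wf_tree n S q j" using Node.prems by auto
  have M: "?m i st < B" if "i < S" for i
  proof -
    have "M ! i \<in> {..<n}" using Node.prems(1) that by (auto simp: vlists_def dest: nth_mem)
    then show ?thesis using Node.prems(5) by simp
  qed
  from Node.prems(8) consider "a \<in> set (compile S l X z U ?m)" | "a \<in> set (compile S r z Y ?m V)"
    | "a \<in> set (compile S q X Y U V)" by auto
  then show ?case
  proof cases
    case 1
    from Node.IH(1)[OF wf(1) z(4) order_refl z(2)[symmetric] Node.prems(5,6) M 1] z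
    show ?thesis by auto
  next
    case 2
    from Node.IH(2)[OF wf(2) order_refl z(5) z(3) Node.prems(5) M Node.prems(7) 2] z
    show ?thesis by auto
  next
    case 3
    from Node.IH(3)[OF wf(3) Node.prems(2-7) 3] show ?thesis .
  qed
qed

section \<open>Shape and length of the compiled programs\<close>

definition bit_pairs :: "op list \<Rightarrow> ((nat \<times> nat) \<times> nat \<times> nat) list" where
  "bit_pairs = map (\<lambda>a. (src_bit a, dst_bit a))"

text \<open>Trees of one level differ in midpoints and coins only, so all of them read and flip the
  same bits in the same order.\<close>

lemma compile_shape:
  assumes "T \<in> trees n S N j" "T' \<in> trees n S N j"
  shows "bit_pairs (compile S T X Y U V) = bit_pairs (compile S T' X Y U' V')"
  using assms
proof (induction j arbitrary: T T' X Y U V U' V')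
  case 0
  then show ?case by (auto simp: bit_pairs_def map_concat comp_def)
next
  case (Suc j)
  note hyp = Suc.IH
  have "T \<in> (mids n S j (trees n S N j) ^^ i) (trees n S N j) \<Longrightarrow>
    T' \<in> (mids n S j (trees n S N j) ^^ i) (trees n S N j) \<Longrightarrow>
    bit_pairs (compile S T X Y U V) = bit_pairs (compile S T' X Y U' V')" for i
  proof (induction i arbitrary: T T')
    case 0
    then show ?case using hyp by simp
  next
    case (Suc i)
    let ?Q = "(mids n S j (trees n S N j) ^^ i) (trees n S N j)"
    have "T \<in> mids n S j (trees n S N j) ?Q" "T' \<in> mids n S j (trees n S N j) ?Q"
      using Suc.prems by simp_all
    then obtain M l r q M' l' r' q' where T: "T = Node j M l r q" "T' = Node j M' l' r' q'"
      and t: "l \<in> trees n S N j" "r \<in> trees n S N j" "l' \<in> trees n S N j" "r' \<in> trees n S N j"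
      and q: "q \<in> ?Q" "q' \<in> ?Q"
      by (elim midsE) blast
    let ?m = "\<lambda>i _ :: nat \<times> nat. M ! i" and ?m' = "\<lambda>i _ :: nat \<times> nat. M' ! i"
    have "bit_pairs (compile S l X j U ?m) = bit_pairs (compile S l' X j U' ?m')"
      "bit_pairs (compile S r j Y ?m V) = bit_pairs (compile S r' j Y ?m' V')"
      using hyp t by blast+
    with Suc.IH[OF q] show ?case by (simp add: T bit_pairs_def)
  qed
  then show ?case using Suc.prems by simp
qed

text \<open>A node calls \<open>l\<close> twice and \<open>r\<close> once, and the chain of
  \<open>N j\<close> nodes ends in one more call of level \<open>j\<close>.\<close>

primrec ops_len :: "nat \<Rightarrow> (nat \<Rightarrow> nat) \<Rightarrow> nat \<Rightarrow> nat" where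
  "ops_len S N 0 = S * S"
| "ops_len S N (Suc j) = (3 * N j + 1) * ops_len S N j"

lemma length_compile:
  assumes "T \<in> trees n S N j"
  shows "length (compile S T X Y U V) = ops_len S N j"
  using assms
proof (induction j arbitrary: T X Y U V)
  case 0
  then show ?case by (auto simp: length_concat comp_def sum_list_triv)
next
  case (Suc j)
  note hyp = Suc.IH
  have "T \<in> (mids n S j (trees n S N j) ^^ i) (trees n S N j) \<Longrightarrow>
    length (compile S T X Y U V) = (3 * i + 1) * ops_len S N j" for i
  proof (induction i arbitrary: T)
    case 0
    then show ?case using hyp by simp
  next
    case (Suc i)
    let ?Q = "(mids n S j (trees n S N j) ^^ i) (trees n S N j)"
    have "T \<in> mids n S j (trees n S N j) ?Q" using Suc.prems by simp
    then obtain M l r q where "T = Node j M l r q" "l \<in> trees n S N j" "r \<in> trees n S N j" "q \<in> ?Q"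
      by (rule midsE)
    then show ?case by (simp add: hyp Suc.IH algebra_simps)
  qed
  then show ?case using Suc.prems by simp
qed

section \<open>The quantum algorithm\<close>

lemma bit_ge: "v < 2 ^ l \<Longrightarrow> l \<le> q \<Longrightarrow> \<not> bit v q" for v :: nat
  by (simp add: nat_less_two_power_iff)

lemma bit_lessD: "v < 2 ^ l \<Longrightarrow> bit v q \<Longrightarrow> q < l" for v :: nat
  using bit_ge not_le by blast

lemma bit_reg_upt: "bit (reg [a..<b] c) i \<longleftrightarrow> a + i < b \<and> bit c (a + i)"
  by (auto simp: bit_reg)

lemma reg_flip: "y \<notin> set qs \<Longrightarrow> reg qs (flip_bit y c) = reg qs c"
  by (auto simp: reg_eq_iff bit_flip)

lemma cflip_xor: "cflip f y c = xor c (push_bit y (of_bool (f c)))"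
  by (simp add: cflip_def flip_bit_eq_xor)

text \<open>The value \<open>v\<close> stays the same while it is written, so running the flips a
  second time removes it again.\<close>

lemma fold_controlled_flips:
  assumes "\<And>c i. i < l \<Longrightarrow> v (flip_bit (a + i) c) = v c"
  shows "fold (cop_fun G) (map (\<lambda>i. Flip (\<lambda>c. bit (v c) i) (a + i)) [0..<l]) c =
    xor c (push_bit a (take_bit l (v c)))"
proof -
  have "fold (cop_fun G) (map (\<lambda>i. Flip (\<lambda>c. bit (v c) i) (a + i)) [0..<l]) c =
    xor c (push_bit a (take_bit l (v c))) \<and>
    v (fold (cop_fun G) (map (\<lambda>i. Flip (\<lambda>c. bit (v c) i) (a + i)) [0..<l]) c) = v c"
    using assms
  proof (induction l)
    case (Suc l)
    let ?c = "fold (cop_fun G) (map (\<lambda>i. Flip (\<lambda>c. bit (v c) i) (a + i)) [0..<l]) c"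
    have IH: "?c = xor c (push_bit a (take_bit l (v c)))" "v ?c = v c"
      using Suc by auto
    have "cflip (\<lambda>c. bit (v c) l) (a + l) ?c = xor c (push_bit a (take_bit (Suc l) (v c)))"
      by (rule bit_eqI) (auto simp: bit_cflip IH(2), auto simp: IH(1) bit_simps less_Suc_eq)
    moreover have "v (cflip (\<lambda>c. bit (v c) l) (a + l) ?c) = v c"
      using Suc.prems[of l] IH(2) by (simp add: cflip_def)
    ultimately show ?case by simp
  qed simp
  then show ?thesis ..
qed

locale machine =
  fixes n k S J R mu :: nat and N :: "nat \<Rightarrow> nat" and F :: "nat \<Rightarrow> tree list"
  assumes n_le: "n \<le> 2 ^ k" and S_pos: "0 < S"
    and F: "\<sigma> < 2 ^ mu \<Longrightarrow> F \<sigma> \<in> forests R (trees n S N J)"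
begin

definition ops :: "nat \<Rightarrow> op list" where
  "ops \<sigma> = concat (map (\<lambda>i. compile S (F \<sigma> ! i) (J + R) (J + i) (\<lambda>_. fst) (\<lambda>_. snd)) [0..<R])"

text \<open>Qubit layout: \<open>s\<close>, \<open>t\<close>, two query registers of \<open>k\<close> qubits each, the query answer, the output, the seed, and
  then the bitmaps: workspace registers \<open>0, \<dots>, J - 1\<close>, target registers \<open>J, \<dots>, J + R - 1\<close> and the source register
  \<open>J + R\<close>, whose slot 0 is the qubit \<open>en\<close> that also drives all \<open>Select\<close> instructions.\<close>

definition sd :: nat where "sd = 4 * k + 2"

definition base :: nat where "base = sd + mu"

definition pos :: "nat \<times> nat \<Rightarrow> nat" where "pos b = base + fst b * S + snd b"

definition en :: nat where "en = pos (J + R, 0)"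

definition width :: nat where "width = base + (J + R + 1) * S"

abbreviation "sreg \<equiv> [0..<k]"
abbreviation "treg \<equiv> [k..<2 * k]"
abbreviation "ureg \<equiv> [2 * k..<3 * k]"
abbreviation "vreg \<equiv> [3 * k..<4 * k]"
abbreviation "ans \<equiv> 4 * k"
abbreviation "outq \<equiv> 4 * k + 1"
abbreviation "seedreg \<equiv> [sd..<base]"

text \<open>The operation is selected by the seed stored in the basis state itself; inside the
  predicate of a flip this becomes part of the table lookup.\<close>

definition cur :: "nat \<Rightarrow> nat \<Rightarrow> op" where
  "cur p c = ops (reg seedreg c) ! p"

definition ufun :: "nat \<Rightarrow> nat \<Rightarrow> nat" where
  "ufun p c = arc_from (cur p c) (reg sreg c, reg treg c)"

definition vfun :: "nat \<Rightarrow> nat \<Rightarrow> nat" where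
  "vfun p c = arc_to (cur p c) (reg sreg c, reg treg c)"

definition load :: "nat \<Rightarrow> (nat \<Rightarrow> nat) \<Rightarrow> cop list" where
  "load a v = map (\<lambda>i. Flip (\<lambda>c. bit (v c) i) (a + i)) [0..<k]"

text \<open>Positions must not depend on the seed. They are read off from seed 0, and
  \<open>ops_nth\<close> shows that all seeds agree.\<close>

definition src :: "nat \<Rightarrow> nat" where "src p = pos (src_bit (ops 0 ! p))"
definition dst :: "nat \<Rightarrow> nat" where "dst p = pos (dst_bit (ops 0 ! p))"

text \<open>Compute the endpoints, query, flip the destination bit, then undo query and endpoints in
  reverse order. The answer, the source bit and the coin together control the flip.\<close>

definition block :: "nat \<Rightarrow> cop list" where
  "block p = load (2 * k) (ufun p) @ load (3 * k) (vfun p) @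
     [Ask ureg vreg ans, Flip (\<lambda>c. bit c ans \<and> bit c (src p) \<and> coin (cur p c)) (dst p), Ask ureg vreg ans] @
     load (3 * k) (vfun p) @ load (2 * k) (ufun p)"

definition main :: "cop list" where
  "main = concat (map block [0..<length (ops 0)]) @ [Flip (\<lambda>c. \<exists>i<R. bit c (pos (J + i, 0))) outq]"

definition alg :: qalg where
  "alg = \<lparr>qubits = width,
     steps = Gate [en] xmat # map (\<lambda>q. Gate [q] hmat) [sd..<sd + mu] @
       map (cop_instr width en) main,
     out_qubit = outq\<rparr>"

section \<open>Addresses, cost and legality of the instructions\<close>

lemma pos_ge: "base \<le> pos b"
  by (simp add: pos_def)

lemma pos_eq_iff: "x < S \<Longrightarrow> y < S \<Longrightarrow> pos (r, x) = pos (r', y) \<longleftrightarrow> r = r' \<and> x = y"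
proof
  assume *: "x < S" "y < S" "pos (r, x) = pos (r', y)"
  then have eq: "r * S + x = r' * S + y" by (simp add: pos_def)
  have "(r * S + x) div S = r" "(r' * S + y) div S = r'" using *(1,2) by simp_all
  then have "r = r'" using eq by simp
  then show "r = r' \<and> x = y" using eq by simp
qed simp

lemma pos_less: "r \<le> J + R \<Longrightarrow> x < S \<Longrightarrow> pos (r, x) < width"
proof -
  assume "r \<le> J + R" "x < S"
  then have "r * S + x < (J + R) * S + S" by (intro add_le_less_mono mult_right_mono) auto
  then show ?thesis by (simp add: pos_def width_def)
qed

lemma ops_less: "a \<in> set (ops \<sigma>) \<Longrightarrow> \<sigma> < 2 ^ mu \<Longrightarrow> s < 2 ^ k \<Longrightarrow> t < 2 ^ k \<Longrightarrow>
    fst (src_bit a) \<le> J + R \<and> snd (src_bit a) < S \<and> fst (dst_bit a) < J + R \<and> snd (dst_bit a) < S \<and>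
    fst (src_bit a) \<noteq> fst (dst_bit a) \<and> arc_from a (s, t) < 2 ^ k \<and> arc_to a (s, t) < 2 ^ k"
proof -
  assume a: "a \<in> set (ops \<sigma>)" "\<sigma> < 2 ^ mu" and st: "s < 2 ^ k" "t < 2 ^ k"
  then obtain i where i: "i < R" "a \<in> set (compile S (F \<sigma> ! i) (J + R) (J + i) (\<lambda>_. fst) (\<lambda>_. snd))"
    by (auto simp: ops_def)
  have "wf_tree n S (F \<sigma> ! i) J"
    by (rule trees_wf) (use F[OF a(2)] i(1) in \<open>auto simp: forests_def dest: nth_mem\<close>)
  from compile_ops[OF this _ _ _ n_le _ _ i(2), of "(s, t)"] st i(1) show ?thesis by auto
qed

lemma ops_shape: "\<sigma> < 2 ^ mu \<Longrightarrow> bit_pairs (ops \<sigma>) = bit_pairs (ops 0)"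
proof -
  assume \<sigma>: "\<sigma> < 2 ^ mu"
  have "bit_pairs (compile S (F \<sigma> ! i) (J + R) (J + i) (\<lambda>_. fst) (\<lambda>_. snd)) =
      bit_pairs (compile S (F 0 ! i) (J + R) (J + i) (\<lambda>_. fst) (\<lambda>_. snd))" if "i < R" for i
    by (rule compile_shape[of _ n S N J])
      (use F[OF \<sigma>] F[of 0] that in \<open>auto simp: forests_def dest: nth_mem\<close>)
  then show ?thesis
    by (auto simp: ops_def bit_pairs_def map_concat intro!: arg_cong[of _ _ concat])
qed

lemma ops_nth:
  assumes "\<sigma> < 2 ^ mu"
  shows "length (ops \<sigma>) = length (ops 0)"
    and "p < length (ops 0) \<Longrightarrow> src_bit (ops \<sigma> ! p) = src_bit (ops 0 ! p)"
    and "p < length (ops 0) \<Longrightarrow> dst_bit (ops \<sigma> ! p) = dst_bit (ops 0 ! p)"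
proof -
  note eq = ops_shape[OF assms]
  show len: "length (ops \<sigma>) = length (ops 0)"
    using arg_cong[OF eq, of length] by (simp add: bit_pairs_def)
  show "src_bit (ops \<sigma> ! p) = src_bit (ops 0 ! p)" "dst_bit (ops \<sigma> ! p) = dst_bit (ops 0 ! p)"
    if "p < length (ops 0)"
    using arg_cong[OF eq, of "\<lambda>xs. xs ! p"] that len by (simp_all add: bit_pairs_def)
qed

lemma length_ops: "length (ops 0) = R * ops_len S N J"
proof -
  have eq: "length (compile S (F 0 ! i) (J + R) (J + i) (\<lambda>_. fst) (\<lambda>_. snd)) = ops_len S N J" if "i < R" for i
    by (rule length_compile[of _ n]) (use F[of 0] that in \<open>auto simp: forests_def dest: nth_mem\<close>)
  have "length (ops 0) =
      sum_list (map (\<lambda>i. length (compile S (F 0 ! i) (J + R) (J + i) (\<lambda>_. fst) (\<lambda>_. snd))) [0..<R])"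
    by (simp add: ops_def length_concat comp_def)
  also have "map (\<lambda>i. length (compile S (F 0 ! i) (J + R) (J + i) (\<lambda>_. fst) (\<lambda>_. snd))) [0..<R] =
      map (\<lambda>_. ops_len S N J) [0..<R]"
    by (rule map_cong) (use eq in auto)
  finally show ?thesis by (simp add: sum_list_triv)
qed

lemma length_main: "length main = length (ops 0) * (4 * k + 3) + 1"
proof -
  have "length (block p) = 4 * k + 3" for p by (simp add: block_def load_def)
  then show ?thesis by (simp add: main_def length_concat comp_def sum_list_triv)
qed

lemma qtime_alg: "qtime alg = mu + R * ops_len S N J * (4 * k + 3) + 2"
  by (simp add: alg_def length_main length_ops)

lemma seed_less: "reg seedreg c < 2 ^ mu"
  using reg_less[of seedreg c] by (simp add: base_def)

lemma vertex_less: "reg sreg c < 2 ^ k" "reg treg c < 2 ^ k"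
  using reg_less[of sreg c] reg_less[of treg c] by simp_all

text \<open>The source register of the root trees is never a destination, hence \<open>dst p\<close>
  differs from \<open>en\<close> and the step qubit keeps the value 1.\<close>

lemma cur_op:
  assumes "p < length (ops 0)"
  shows "src p = pos (src_bit (cur p c))" "dst p = pos (dst_bit (cur p c))"
    and "src p < width" "dst p < width" "src p \<noteq> dst p" "dst p \<noteq> en" "base \<le> src p" "base \<le> dst p"
    and "ufun p c < 2 ^ k" "vfun p c < 2 ^ k"
proof -
  let ?a = "cur p c"
  have a: "?a \<in> set (ops (reg seedreg c))"
    unfolding cur_def using assms ops_nth(1)[OF seed_less[of c]] by (metis nth_mem)
  note * = ops_less[OF a seed_less vertex_less(1)[of c] vertex_less(2)[of c]]
  show s: "src p = pos (src_bit ?a)" "dst p = pos (dst_bit ?a)"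
    unfolding src_def dst_def cur_def using ops_nth[OF seed_less[of c]] assms by simp_all
  obtain r x r' y where b: "src_bit ?a = (r, x)" "dst_bit ?a = (r', y)" by (metis surj_pair)
  show "src p < width" "dst p < width" unfolding s b using * b by (auto intro!: pos_less)
  show "src p \<noteq> dst p" "dst p \<noteq> en" unfolding s b en_def using * b S_pos by (auto simp: pos_eq_iff)
  show "base \<le> src p" "base \<le> dst p" unfolding s by (rule pos_ge)+
  show "ufun p c < 2 ^ k" "vfun p c < 2 ^ k" unfolding ufun_def vfun_def using * by auto
qed

lemma funs_flip:
  assumes "y \<notin> set sreg" "y \<notin> set treg" "y \<notin> set seedreg"
  shows "cur p (flip_bit y c) = cur p c" "ufun p (flip_bit y c) = ufun p c" "vfun p (flip_bit y c) = vfun p c"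
  by (simp_all only: cur_def ufun_def vfun_def reg_flip[OF assms(1)] reg_flip[OF assms(2)] reg_flip[OF assms(3)])

lemma scratch_flip:
  assumes "2 * k \<le> y" "y \<le> 4 * k + 1 \<or> base \<le> y"
  shows "cur p (flip_bit y c) = cur p c" "ufun p (flip_bit y c) = ufun p c" "vfun p (flip_bit y c) = vfun p c"
proof -
  have y: "y \<notin> set sreg" "y \<notin> set treg" "y \<notin> set seedreg"
    using assms by (auto simp: base_def sd_def)
  show "cur p (flip_bit y c) = cur p c" "ufun p (flip_bit y c) = ufun p c" "vfun p (flip_bit y c) = vfun p c"
    by (rule funs_flip[OF y])+
qed

lemma en_bounds: "en < width" "base \<le> en"
  unfolding en_def using S_pos by (auto intro: pos_less pos_ge)

lemma main_ok: "\<forall>I\<in>set main. cop_ok k width en I"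
proof -
  have load: "cop_ok k width en I"
    if "I \<in> set (load a (ufun p)) \<or> I \<in> set (load a (vfun p))" "2 * k \<le> a" "a + k \<le> 4 * k" for I a p
    using that en_bounds scratch_flip[of _ p]
    by (auto simp: load_def width_def base_def sd_def)
  have "cop_ok k width en I" if p: "p < length (ops 0)" and I: "I \<in> set (block p)" for p I
  proof -
    from I consider "I \<in> set (load (2 * k) (ufun p)) \<or> I \<in> set (load (3 * k) (vfun p))"
      | "I = Ask ureg vreg ans"
      | "I = Flip (\<lambda>c. bit c ans \<and> bit c (src p) \<and> coin (cur p c)) (dst p)"
      by (auto simp: block_def)
    then show ?thesis
    proof cases
      case 1
      then show ?thesis using load[of I "2 * k" p] load[of I "3 * k" p] by auto
    next
      case 2
      then show ?thesis using en_bounds by (auto simp: width_def base_def sd_def)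
    next
      case 3
      have "ans \<noteq> dst p" using cur_op(8)[OF p] by (simp add: base_def sd_def)
      moreover have "cur p (flip_bit (dst p) c) = cur p c" for c
        by (rule scratch_flip) (use cur_op(8)[OF p] in \<open>auto simp: base_def sd_def\<close>)
      ultimately show ?thesis
        using 3 cur_op[OF p] en_bounds by (simp add: bit_flip)
    qed
  qed
  moreover have "cop_ok k width en (Flip (\<lambda>c. \<exists>i<R. bit c (pos (J + i, 0))) outq)"
  proof -
    have "pos b \<noteq> outq" for b using pos_ge[of b] by (simp add: base_def sd_def)
    then show ?thesis using en_bounds by (auto simp: bit_flip width_def base_def sd_def)
  qed
  ultimately show ?thesis by (auto simp: main_def)
qed

lemma st_algorithm_alg:
  assumes "k = ceillog2 n"
  shows "st_algorithm n alg"
proof -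
  have "unit_cost k {..<width} I" if "I \<in> set (steps alg)" for I
  proof -
    from that consider "I = Gate [en] xmat" | q where "sd \<le> q" "q < sd + mu" "I = Gate [q] hmat"
      | J where "J \<in> set main" "I = cop_instr width en J"
      by (auto simp: alg_def)
    then show ?thesis
    proof cases
      case 1
      then show ?thesis using en_bounds by (auto intro: unit_cost_gate xmat_unitary xmat_carrier)
    next
      case 2
      then show ?thesis
        by (auto intro!: unit_cost_gate hmat_unitary hmat_carrier simp: width_def base_def sd_def)
    next
      case 3
      then show ?thesis using main_ok by (auto intro: unit_cost_cop)
    qed
  qed
  then show ?thesis
    unfolding st_algorithm_def assms[symmetric] by (simp add: alg_def) (simp add: width_def base_def sd_def)
qed

section \<open>Net effect of one block\<close>

lemma fold_load_ufun:
  assumes "p < length (ops 0)" "2 * k \<le> a" "a + k \<le> 4 * k"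
  shows "fold (cop_fun G) (load a (ufun p)) c = xor c (push_bit a (ufun p c))"
    and "fold (cop_fun G) (load a (vfun p)) c = xor c (push_bit a (vfun p c))"
proof -
  have "take_bit k (ufun p c) = ufun p c" "take_bit k (vfun p c) = vfun p c"
    using cur_op(9,10)[OF assms(1)] by (simp_all add: take_bit_nat_eq_self_iff)
  moreover have "ufun p (flip_bit (a + i) c) = ufun p c" "vfun p (flip_bit (a + i) c) = vfun p c"
    if "i < k" for i c
    using scratch_flip[of "a + i" p c] that assms by auto
  ultimately show "fold (cop_fun G) (load a (ufun p)) c = xor c (push_bit a (ufun p c))"
    "fold (cop_fun G) (load a (vfun p)) c = xor c (push_bit a (vfun p c))"
    unfolding load_def by (simp_all add: fold_controlled_flips)
qed

lemma funs_cong: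
  assumes "\<And>q. q < 2 * k \<or> sd \<le> q \<and> q < base \<Longrightarrow> bit c q = bit c' q"
  shows "cur p c = cur p c'" "ufun p c = ufun p c'" "vfun p c = vfun p c'"
proof -
  have "reg sreg c = reg sreg c'" "reg treg c = reg treg c'" "reg seedreg c = reg seedreg c'"
    using assms by (auto simp: reg_eq_iff)
  then show "cur p c = cur p c'" "ufun p c = ufun p c'" "vfun p c = vfun p c'"
    by (simp_all add: cur_def ufun_def vfun_def)
qed

text \<open>No step changes \<open>s\<close>, \<open>t\<close> or the seed, so \<open>ufun\<close>,
  \<open>vfun\<close> and \<open>cur\<close> return the same values in all intermediate states, and
  the second half of the block cancels the first.\<close>

lemma fold_block:
  assumes p: "p < length (ops 0)" and clean: "\<And>q. 2 * k \<le> q \<Longrightarrow> q \<le> 4 * k \<Longrightarrow> \<not> bit c q"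
  shows "fold (cop_fun G) (block p) c =
    cflip (\<lambda>c. (ufun p c, vfun p c) \<in> parcs G \<and> bit c (src p) \<and> coin (cur p c)) (dst p) c"
proof -
  define u where "u = ufun p c"
  define v where "v = vfun p c"
  define w where "w = ((u, v) \<in> parcs G)"
  define b where "b = (w \<and> bit c (src p) \<and> coin (cur p c))"
  have uv: "u < 2 ^ k" "v < 2 ^ k" using cur_op[OF p] by (simp_all add: u_def v_def)
  have far: "base \<le> src p" "base \<le> dst p" "sd \<le> base" "sd = 4 * k + 2" "src p \<noteq> dst p"
    using cur_op[OF p] by (simp_all add: base_def sd_def)
  have pu: "bit (push_bit (2 * k) u) q \<longleftrightarrow> 2 * k \<le> q \<and> q < 3 * k \<and> bit u (q - 2 * k)" for q
    using bit_lessD[OF uv(1), of "q - 2 * k"] by (auto simp: bit_push_bit_iff_nat)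
  have pv: "bit (push_bit (3 * k) v) q \<longleftrightarrow> 3 * k \<le> q \<and> q < 4 * k \<and> bit v (q - 3 * k)" for q
    using bit_lessD[OF uv(2), of "q - 3 * k"] by (auto simp: bit_push_bit_iff_nat)
  have pb: "bit (push_bit a (of_bool d :: nat)) q \<longleftrightarrow> q = a \<and> d" for a q d
    by (cases d) (auto simp: bit_exp_iff)
  define c1 where "c1 = xor c (push_bit (2 * k) u)"
  define c2 where "c2 = xor c1 (push_bit (3 * k) v)"
  define c3 where "c3 = xor c2 (push_bit ans (of_bool w))"
  define c4 where "c4 = xor c3 (push_bit (dst p) (of_bool b))"
  define c5 where "c5 = xor c4 (push_bit ans (of_bool w))"
  define c6 where "c6 = xor c5 (push_bit (3 * k) v)"
  note defs = c1_def c2_def c3_def c4_def c5_def c6_def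
  have low: "bit c1 q = bit c q" "bit c2 q = bit c q" "bit c3 q = bit c q" "bit c4 q = bit c q"
    "bit c5 q = bit c q" "bit c6 q = bit c q"
    if "q < 2 * k \<or> sd \<le> q \<and> q < base" for q
  proof -
    have "\<not> bit (push_bit (2 * k) u) q" "\<not> bit (push_bit (3 * k) v) q"
      "\<not> bit (push_bit ans (of_bool w :: nat)) q" "\<not> bit (push_bit (dst p) (of_bool b :: nat)) q"
      unfolding pu pv pb using that far by linarith+
    then show "bit c1 q = bit c q" "bit c2 q = bit c q" "bit c3 q = bit c q" "bit c4 q = bit c q"
      "bit c5 q = bit c q" "bit c6 q = bit c q"
      by (simp_all only: defs bit_xor_iff) simp_all
  qed
  \<comment> \<open>At both queries the query registers hold \<open>u\<close> and \<open>v\<close>;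
    the shift by \<open>k\<close> treats the two registers at once.\<close>
  have ubit: "bit d q = bit (push_bit (2 * k) u) q" "bit d (q + k) = bit (push_bit (3 * k) v) (q + k)"
    if "2 * k \<le> q" "q < 3 * k" "d = c2 \<or> d = c4" for d q
  proof -
    have "\<not> bit (push_bit (3 * k) v) q" "\<not> bit (push_bit (2 * k) u) (q + k)"
      "\<not> bit (push_bit ans (of_bool w :: nat)) q" "\<not> bit (push_bit ans (of_bool w :: nat)) (q + k)"
      "\<not> bit (push_bit (dst p) (of_bool b :: nat)) q" "\<not> bit (push_bit (dst p) (of_bool b :: nat)) (q + k)"
      unfolding pu pv pb using that(1,2) far by linarith+
    moreover have "\<not> bit c q" "\<not> bit c (q + k)"
      by (rule clean; use that(1,2) in linarith)+
    ultimately show "bit d q = bit (push_bit (2 * k) u) q" "bit d (q + k) = bit (push_bit (3 * k) v) (q + k)"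
      using that(3) by (auto simp only: defs bit_xor_iff)
  qed
  have ur: "reg ureg d = u" "reg vreg d = v" if d: "d = c2 \<or> d = c4" for d
  proof -
    have "bit (reg ureg d) i = bit u i" for i
      using ubit(1)[OF _ _ d, of "2 * k + i"] bit_lessD[OF uv(1), of i]
      by (auto simp: bit_reg_upt pu)
    then show "reg ureg d = u" by (intro bit_eqI)
    have "bit (reg vreg d) i = bit v i" for i
    proof -
      have "2 * k + i + k = 3 * k + i" by simp
      from ubit(2)[OF _ _ d, of "2 * k + i", unfolded this] bit_lessD[OF uv(2), of i]
      show ?thesis by (auto simp: bit_reg_upt pv)
    qed
    then show "reg vreg d = v" by (intro bit_eqI)
  qed
  have f1: "fold (cop_fun G) (load (2 * k) (ufun p)) c = c1"
    using fold_load_ufun[OF p, of "2 * k"] by (simp add: c1_def u_def)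
  have f2: "fold (cop_fun G) (load (3 * k) (vfun p)) c1 = c2"
    using fold_load_ufun[OF p, of "3 * k"] funs_cong(3)[OF low(1)] by (simp add: c2_def v_def)
  have f3: "cop_fun G (Ask ureg vreg ans) c2 = c3"
    by (simp add: cflip_xor ur c3_def w_def)
  have "\<not> bit (push_bit (2 * k) u) q" "\<not> bit (push_bit (3 * k) v) q"
    if "q = ans \<or> q = src p" for q
    unfolding pu pv using that far by linarith+
  moreover have "ans \<noteq> src p" "\<not> bit c ans" using far clean[of ans] by auto
  ultimately have "bit c3 ans = w" "bit c3 (src p) = bit c (src p)"
    unfolding c3_def c2_def c1_def bit_xor_iff pb by auto
  moreover have "cur p c3 = cur p c" by (rule funs_cong(1)[OF low(3)])
  ultimately have f4: "cop_fun G (Flip (\<lambda>c. bit c ans \<and> bit c (src p) \<and> coin (cur p c)) (dst p)) c3 = c4"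
    by (simp add: cflip_xor c4_def b_def)
  have f5: "cop_fun G (Ask ureg vreg ans) c4 = c5"
    by (simp add: cflip_xor ur c5_def w_def)
  have f6: "fold (cop_fun G) (load (3 * k) (vfun p)) c5 = c6"
    using fold_load_ufun[OF p, of "3 * k"] funs_cong(3)[OF low(5)] by (simp add: c6_def v_def)
  have f7: "fold (cop_fun G) (load (2 * k) (ufun p)) c6 = xor c6 (push_bit (2 * k) u)"
    using fold_load_ufun[OF p, of "2 * k"] funs_cong(2)[OF low(6)] by (simp add: u_def)
  have "fold (cop_fun G) (block p) c = xor c6 (push_bit (2 * k) u)"
    unfolding block_def fold_append o_apply fold_Cons fold_Nil id_apply f1 f2 f3 f4 f5 f6 f7 ..
  also have "\<dots> = xor c (push_bit (dst p) (of_bool b))"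
    by (rule bit_eqI) (simp only: defs bit_xor_iff, blast)
  finally show ?thesis by (simp add: cflip_xor b_def w_def u_def v_def)
qed

section \<open>Simulation of the straight-line program on basis states\<close>

definition rep :: "nat \<Rightarrow> nat \<Rightarrow> nat \<Rightarrow> (nat \<times> nat \<Rightarrow> bool) \<Rightarrow> nat \<Rightarrow> bool" where
  "rep \<sigma> s t f c \<longleftrightarrow> reg sreg c = s \<and> reg treg c = t \<and> reg seedreg c = \<sigma> \<and>
     (\<forall>q. 2 * k \<le> q \<longrightarrow> q \<le> 4 * k + 1 \<longrightarrow> \<not> bit c q) \<and>
     (\<forall>r x. r \<le> J + R \<longrightarrow> x < S \<longrightarrow> bit c (pos (r, x)) = f (r, x))"

text \<open>\<open>rep\<close> demands clean scratch, answer and output qubits and bitmaps given by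
  \<open>f\<close>. It is preserved because the net flip of a block has the condition of
  \<open>exec\<close> for the stored seed as its predicate.\<close>

lemma rep_block:
  assumes p: "p < length (ops 0)" and rep: "rep \<sigma> s t f c"
  shows "rep \<sigma> s t (exec (parcs G) (s, t) (ops \<sigma> ! p) f) (fold (cop_fun G) (block p) c)"
proof -
  have c: "reg sreg c = s" "reg treg c = t" "reg seedreg c = \<sigma>"
    "\<And>q. 2 * k \<le> q \<Longrightarrow> q \<le> 4 * k + 1 \<Longrightarrow> \<not> bit c q"
    "\<And>r x. r \<le> J + R \<Longrightarrow> x < S \<Longrightarrow> bit c (pos (r, x)) = f (r, x)"
    using rep by (auto simp: rep_def)
  let ?a = "ops \<sigma> ! p"
  have cur: "cur p c = ?a" by (simp add: cur_def c)
  have a: "?a \<in> set (ops \<sigma>)" and \<sigma>: "\<sigma> < 2 ^ mu"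
    using p ops_nth(1)[of \<sigma>] seed_less[of c] c(3) by (auto intro!: nth_mem)
  have st: "s < 2 ^ k" "t < 2 ^ k" using vertex_less[of c] c by auto
  note * = ops_less[OF a \<sigma> st]
  obtain r x r' y where b: "src_bit ?a = (r, x)" "dst_bit ?a = (r', y)" by (metis surj_pair)
  have sd: "src p = pos (r, x)" "dst p = pos (r', y)"
    using cur_op(1,2)[OF p, of c] by (simp_all add: cur b)
  have src: "bit c (src p) = f (src_bit ?a)" using c(5)[of r x] * sd b by simp
  define C where "C \<longleftrightarrow> coin ?a \<and> f (src_bit ?a) \<and> (arc_from ?a (s, t), arc_to ?a (s, t)) \<in> parcs G"
  have eq: "fold (cop_fun G) (block p) c = (if C then flip_bit (dst p) c else c)"
    using fold_block[OF p, of c G] c(4)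
    by (auto simp: cflip_def C_def ufun_def vfun_def cur src c)
  have far: "base \<le> dst p" "sd \<le> base" "sd = 4 * k + 2" using cur_op(8)[OF p] by (simp_all add: base_def sd_def)
  have "rep \<sigma> s t (f(dst_bit ?a := \<not> f (dst_bit ?a))) (flip_bit (dst p) c)"
    unfolding rep_def
  proof (intro conjI allI impI)
    show "reg sreg (flip_bit (dst p) c) = s" "reg treg (flip_bit (dst p) c) = t"
      "reg seedreg (flip_bit (dst p) c) = \<sigma>"
      using far c by (simp_all add: reg_flip)
    show "\<not> bit (flip_bit (dst p) c) q" if "2 * k \<le> q" "q \<le> 4 * k + 1" for q
      using far that c(4)[of q] by (auto simp: bit_flip)
    show "bit (flip_bit (dst p) c) (pos (i, j)) = (f(dst_bit ?a := \<not> f (dst_bit ?a))) (i, j)"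
      if "i \<le> J + R" "j < S" for i j
      using that c(5) * b by (auto simp: bit_flip sd pos_eq_iff)
  qed
  then show ?thesis using rep by (simp add: eq exec_def C_def)
qed

lemma rep_blocks:
  assumes "rep \<sigma> s t f c"
  shows "rep \<sigma> s t (fold (exec (parcs G) (s, t)) (ops \<sigma>) f)
    (fold (cop_fun G) (concat (map block [0..<length (ops 0)])) c)"
proof -
  have "\<sigma> < 2 ^ mu" using assms seed_less[of c] by (simp add: rep_def)
  then have len: "length (ops \<sigma>) = length (ops 0)" by (rule ops_nth)
  have "rep \<sigma> s t (fold (exec (parcs G) (s, t)) (take p (ops \<sigma>)) f)
    (fold (cop_fun G) (concat (map block [0..<p])) c)" if "p \<le> length (ops 0)" for p
    using that
  proof (induction p)
    case (Suc p)
    then show ?case using rep_block[of p] len by (simp add: take_Suc_conv_app_nth)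
  qed (use assms in simp)
  from this[of "length (ops 0)"] len show ?thesis by simp
qed

abbreviation start :: "nat \<times> nat \<Rightarrow> bool" where
  "start \<equiv> \<lambda>(r, x). r = J + R \<and> x = 0"

lemma exec_ops:
  assumes \<sigma>: "\<sigma> < 2 ^ mu" and i: "i < R"
  shows "fold (exec E (s, t)) (ops \<sigma>) start (J + i, 0) =
    den S E (F \<sigma> ! i) (\<lambda>_. s) (\<lambda>_. t) (\<lambda>x. x = 0) 0"
proof -
  let ?d = "\<lambda>i. den S E (F \<sigma> ! i) (\<lambda>_. s) (\<lambda>_. t) (\<lambda>x. x = 0)"
  have "fold (exec E (s, t))
      (concat (map (\<lambda>i. compile S (F \<sigma> ! i) (J + R) (J + i) (\<lambda>_. fst) (\<lambda>_. snd)) [0..<l])) start =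
    (\<lambda>(r, y). if J \<le> r \<and> r < J + l then y < S \<and> ?d (r - J) y else start (r, y))" if "l \<le> R" for l
    using that
  proof (induction l)
    case (Suc l)
    let ?f = "\<lambda>(r, y). if J \<le> r \<and> r < J + l then y < S \<and> ?d (r - J) y else start (r, y)"
    have wf: "wf_tree n S (F \<sigma> ! l) J"
      by (rule trees_wf) (use F[OF \<sigma>] Suc.prems in \<open>auto simp: forests_def dest: nth_mem\<close>)
    have src: "(\<lambda>x. ?f (J + R, x)) = (\<lambda>x. x = 0)" using Suc.prems by auto
    have "fold (exec E (s, t)) (compile S (F \<sigma> ! l) (J + R) (J + l) (\<lambda>_. fst) (\<lambda>_. snd)) ?f =
        (\<lambda>(r, y). if r = J + l \<and> y < S \<and> ?d l y then \<not> ?f (r, y) else ?f (r, y))"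
      using exec_compile[OF wf, of "J + R" "J + l" ?f E "(s, t)" "\<lambda>_. fst" "\<lambda>_. snd"] Suc.prems
      unfolding src by auto
    also have "\<dots> = (\<lambda>(r, y). if J \<le> r \<and> r < J + Suc l then y < S \<and> ?d (r - J) y else start (r, y))"
      using Suc.prems by (auto simp: fun_eq_iff less_Suc_eq)
    finally show ?case using Suc by simp
  qed auto
  from this[of R] i S_pos show ?thesis by (simp add: ops_def)
qed

section \<open>Initial states and output probability\<close>

definition init :: "nat \<Rightarrow> nat \<Rightarrow> nat \<Rightarrow> nat" where
  "init s t \<sigma> = xor (flip_bit en (s + 2 ^ k * t)) (push_bit sd \<sigma>)"

lemma bit_pair:
  fixes s t :: nat
  assumes "s < 2 ^ k"
  shows "bit (s + 2 ^ k * t) q \<longleftrightarrow> (if q < k then bit s q else bit t (q - k))"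
proof -
  have "s + 2 ^ k * t = or s (push_bit k t)"
    unfolding push_bit_eq_mult mult.commute[of t]
    by (rule disjunctive_add)
      (use bit_ge[OF assms] in \<open>auto simp: mult.commute[of "2 ^ k"] bit_push_bit_iff not_le simp flip: push_bit_eq_mult\<close>)
  then show ?thesis using bit_ge[OF assms] by (auto simp: bit_simps)
qed

lemma bit_init:
  assumes "s < 2 ^ k" "t < 2 ^ k" "\<sigma> < 2 ^ mu"
  shows "bit (init s t \<sigma>) q \<longleftrightarrow> q < k \<and> bit s q \<or> k \<le> q \<and> q < 2 * k \<and> bit t (q - k) \<or>
    sd \<le> q \<and> q < base \<and> bit \<sigma> (q - sd) \<or> q = en"
proof -
  have "base \<le> en" "2 * k \<le> sd" "sd \<le> base" "base = sd + mu"
    using en_bounds by (simp_all add: base_def sd_def)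
  moreover have "bit t (q - k) \<Longrightarrow> q < 2 * k" using bit_lessD[OF assms(2), of "q - k"] by linarith
  moreover have "bit \<sigma> (q - sd) \<Longrightarrow> q < sd + mu" using bit_lessD[OF assms(3), of "q - sd"] by linarith
  moreover have "bit s q \<Longrightarrow> q < k" by (rule bit_lessD[OF assms(1)])
  ultimately show ?thesis
    by (auto simp: init_def bit_xor_iff bit_push_bit_iff_nat bit_flip bit_pair[OF assms(1)])
qed

lemma rep_init:
  assumes "s < 2 ^ k" "t < 2 ^ k" "\<sigma> < 2 ^ mu"
  shows "rep \<sigma> s t start (init s t \<sigma>)" "init s t \<sigma> < 2 ^ width" "bit (init s t \<sigma>) en"
proof -
  note bi = bit_init[OF assms] and en = en_bounds
  have sd: "base = sd + mu" "4 * k + 1 < sd" by (simp_all add: base_def sd_def)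
  show "init s t \<sigma> < 2 ^ width"
    unfolding nat_less_two_power_iff using en sd by (auto simp: bi)
  show "bit (init s t \<sigma>) en" by (simp add: bi)
  have "reg sreg (init s t \<sigma>) = s"
    by (rule bit_eqI) (use en sd in \<open>auto simp: bit_reg_upt bi dest: bit_lessD[OF assms(1)]\<close>)
  moreover have "reg treg (init s t \<sigma>) = t"
    by (rule bit_eqI) (use en sd in \<open>auto simp: bit_reg_upt bi dest: bit_lessD[OF assms(2)]\<close>)
  moreover have "reg seedreg (init s t \<sigma>) = \<sigma>"
    by (rule bit_eqI) (use en sd in \<open>auto simp: bit_reg_upt bi dest: bit_lessD[OF assms(3)]\<close>)
  moreover have "\<not> bit (init s t \<sigma>) q" if "2 * k \<le> q" "q \<le> 4 * k + 1" for q
    using that en sd by (auto simp: bi)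
  moreover have "bit (init s t \<sigma>) (pos (r, x)) = start (r, x)" if "x < S" for r x
    using that pos_ge[of "(r, x)"] sd S_pos by (auto simp: bi en_def pos_eq_iff)
  ultimately show "rep \<sigma> s t start (init s t \<sigma>)" by (simp add: rep_def)
qed

lemma bit_out:
  assumes "s < 2 ^ k" "t < 2 ^ k" "\<sigma> < 2 ^ mu"
  shows "bit (fold (cop_fun G) main (init s t \<sigma>)) outq \<longleftrightarrow> \<not> miss S (parcs G) s t (F \<sigma>)"
proof -
  let ?c = "fold (cop_fun G) (concat (map block [0..<length (ops 0)])) (init s t \<sigma>)"
  have "rep \<sigma> s t (fold (exec (parcs G) (s, t)) (ops \<sigma>) start) ?c"
    by (rule rep_blocks[OF rep_init(1)[OF assms]])
  then have c: "\<not> bit ?c outq"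
    "\<And>i. i < R \<Longrightarrow> bit ?c (pos (J + i, 0)) = fold (exec (parcs G) (s, t)) (ops \<sigma>) start (J + i, 0)"
    using S_pos by (auto simp: rep_def)
  have len: "length (F \<sigma>) = R" using F[OF assms(3)] by (simp add: forests_def)
  have "bit (fold (cop_fun G) main (init s t \<sigma>)) outq \<longleftrightarrow> (\<exists>i<R. bit ?c (pos (J + i, 0)))"
    using c(1) by (simp add: main_def bit_cflip)
  also have "\<dots> \<longleftrightarrow> (\<exists>i<R. den S (parcs G) (F \<sigma> ! i) (\<lambda>_. s) (\<lambda>_. t) (\<lambda>x. x = 0) 0)"
    using c(2) exec_ops[OF assms(3)] by auto
  also have "\<dots> \<longleftrightarrow> \<not> miss S (parcs G) s t (F \<sigma>)"
    unfolding miss_def all_set_conv_all_nth len by blast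
  finally show ?thesis .
qed

text \<open>Different seeds start in different basis states and the classical run is injective, so
  the final state is uniform over one basis state per seed. A measurement thus returns the answer of
  a uniformly random seed.\<close>

lemma prob_output_alg:
  assumes "k = ceillog2 n" "s < 2 ^ k" "t < 2 ^ k"
  shows "prob_output n alg G s t b = card {\<sigma>. \<sigma> < 2 ^ mu \<and> (\<not> miss S (parcs G) s t (F \<sigma>)) = b} / 2 ^ mu"
proof -
  let ?p = "fold (cop_fun G) main"
  let ?C = "init s t ` {..<2 ^ mu}"
  let ?ap = "fold (\<lambda>I v. instr_mat width G I *\<^sub>v v)"
  have w: "width = base + (J + R + 1) * S" "base = sd + mu" "sd = 4 * k + 2"
    by (simp_all add: width_def base_def sd_def)
  have st: "s + 2 ^ k * t < 2 ^ width"
    unfolding nat_less_two_power_iff bit_pair[OF assms(2)] using w by (auto dest!: bit_lessD[OF assms(3)])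
  have fl: "flip_bit en (s + 2 ^ k * t) < 2 ^ width" using st en_bounds by (simp add: flip_less)
  have unit: "unit_vec (2 ^ width) (s + 2 ^ k * t) = uni width {s + 2 ^ k * t}"
    by (rule eq_vecI) (auto simp: uni_def unit_vec_def)
  have "?ap (map (\<lambda>q. Gate [q] hmat) [sd..<sd + mu]) (uni width {flip_bit en (s + 2 ^ k * t)}) =
      uni width ((\<lambda>\<sigma>. xor (flip_bit en (s + 2 ^ k * t)) (push_bit sd \<sigma>)) ` {..<2 ^ mu})"
  proof (rule hadamards_uni)
    show "\<not> bit (flip_bit en (s + 2 ^ k * t)) q" if "sd \<le> q" "q < sd + mu" for q
      using that en_bounds w by (auto simp: bit_flip bit_pair[OF assms(2)] dest!: bit_lessD[OF assms(3)])
  qed (use fl w in auto)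
  then have h: "?ap (map (\<lambda>q. Gate [q] hmat) [sd..<sd + mu]) (uni width {flip_bit en (s + 2 ^ k * t)}) =
      uni width ?C" by (simp add: init_def[abs_def])
  have C: "c < 2 ^ width \<and> bit c en" if "c \<in> ?C" for c
    using that rep_init(2,3)[OF assms(2,3)] by auto
  note fa = fold_acts_uni[OF main_ok C]
  have fs: "final_state n alg G s t = uni width (?p ` ?C)"
    unfolding final_state_def assms(1)[symmetric]
    by (simp add: alg_def unit xgate_uni[OF en_bounds(1) st] h fa(1) del: instr_mat.simps)
  have inj: "inj_on (\<lambda>\<sigma>. ?p (init s t \<sigma>)) {..<2 ^ mu}"
  proof (rule inj_onI)
    fix \<sigma> \<tau> :: nat assume "\<sigma> \<in> {..<2 ^ mu}" "\<tau> \<in> {..<2 ^ mu}" "?p (init s t \<sigma>) = ?p (init s t \<tau>)"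
    moreover from this(3) have "init s t \<sigma> = init s t \<tau>" using fa(2) by (simp add: inj_eq)
    ultimately show "\<sigma> = \<tau>"
      using rep_init(1)[OF assms(2,3)] unfolding rep_def by (metis lessThan_iff)
  qed
  have im: "?p ` ?C = (\<lambda>\<sigma>. ?p (init s t \<sigma>)) ` {..<2 ^ mu}" by (simp add: image_image)
  have card: "card (?p ` ?C) = 2 ^ mu" unfolding im using inj by (simp add: card_image)
  have less: "i < 2 ^ width" if "i \<in> ?p ` ?C" for i
    using that fa(3) by blast
  have "prob_output n alg G s t b = (\<Sum>i | i < 2 ^ width \<and> bit i outq = b. (cmod (uni width (?p ` ?C) $ i))\<^sup>2)"
  proof -
    have "qubits alg = width" "out_qubit alg = outq" by (simp_all add: alg_def)
    then show ?thesis by (simp only: prob_output_def fs)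
  qed
  also have "\<dots> = (\<Sum>i | i \<in> ?p ` ?C \<and> bit i outq = b. 1 / 2 ^ mu)"
  proof (rule sum.mono_neutral_cong_right)
    show "finite {i :: nat. i < 2 ^ width \<and> bit i outq = b}" by simp
    show "{i. i \<in> ?p ` ?C \<and> bit i outq = b} \<subseteq> {i. i < 2 ^ width \<and> bit i outq = b}"
      using less by blast
  qed (auto simp: uni_def card less power_divide norm_divide)
  also have "\<dots> = card {i. i \<in> ?p ` ?C \<and> bit i outq = b} / 2 ^ mu" by simp
  also have "{i. i \<in> ?p ` ?C \<and> bit i outq = b} =
      (\<lambda>\<sigma>. ?p (init s t \<sigma>)) ` {\<sigma>. \<sigma> < 2 ^ mu \<and> (\<not> miss S (parcs G) s t (F \<sigma>)) = b}"
    using bit_out[OF assms(2,3)] by (auto simp: im)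
  also have "card \<dots> = card {\<sigma>. \<sigma> < 2 ^ mu \<and> (\<not> miss S (parcs G) s t (F \<sigma>)) = b}"
    by (rule card_image) (rule inj_on_subset[OF inj], auto)
  finally show ?thesis .
qed

end

section \<open>Parameters and running time\<close>

lemma dstcon_iff:
  assumes "pair_fin_digraph G" "s \<in> pverts G"
  shows "dstcon G s t \<longleftrightarrow> (s, t) \<in> (parcs G)\<^sup>*"
proof -
  interpret pair_fin_digraph G by fact
  have "dstcon G s t \<longleftrightarrow> s \<rightarrow>\<^sup>*\<^bsub>with_proj G\<^esub> t"
    unfolding dstcon_def reachable_apath ..
  also have "\<dots> \<longleftrightarrow> (s, t) \<in> (parcs G)\<^sup>*"
    using assms(2) by (subst reachable_conv') simp_all
  finally show ?thesis .
qed

text \<open>The exponents 17 and 16 are large enough for the saving of a factor \<open>2 ^ 16\<close> per level to outweigh the factor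
  \<open>3 * 32 + 1\<close> per level, the rounding of \<open>log n\<close> and all polynomial factors.\<close>

definition slots :: "nat \<Rightarrow> nat" where
  "slots k = 2 ^ 17 * (k + 1)"

definition samples :: "nat \<Rightarrow> nat \<Rightarrow> nat" where
  "samples k j = 32 * 2 ^ (k - j - 16)"

text \<open>Since 2^17 * 32 = 64 * 2^16, the factor 2^16 taken out of the number of samples is put
  back by the slots. Truncated subtraction can only increase the number of samples.\<close>

lemma sampling_params:
  assumes "1 \<le> n" "n \<le> 2 ^ k"
  shows "sampling n (slots k) (samples k) (k + 1)"
proof
  fix j
  have "64 * n * (k + 1) \<le> 64 * 2 ^ k * (k + 1)"
    by (intro mult_right_mono mult_left_mono assms(2)) auto
  also have "\<dots> \<le> 64 * 2 ^ (16 + (k - j - 16) + j) * (k + 1)"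
    by (intro mult_right_mono mult_left_mono power_increasing) auto
  also have "\<dots> = samples k j * slots k * 2 ^ j"
    by (simp add: samples_def slots_def power_add algebra_simps)
  finally show "64 * n * (k + 1) \<le> samples k j * slots k * 2 ^ j" .
qed (use assms in \<open>auto simp: samples_def\<close>)

text \<open>Half of 2^(k + 1) is still at least n: one extra level compensates for the accumulated
  loss in \<open>range_len\<close>.\<close>

lemma range_len_params:
  assumes "n \<le> 2 ^ k"
  shows "n \<le> range_len (k + 1) (k + 1)"
proof -
  have "real n \<le> 2 ^ k" using of_nat_mono[OF assms, where 'a = real] by simp
  also have "\<dots> \<le> range_len (k + 1) (k + 1)"
    using range_len_ge_half[of "k + 1" "k + 1"] by simp
  finally show ?thesis by simp
qed

definition good_forests :: "nat \<Rightarrow> nat \<Rightarrow> (nat \<Rightarrow> tree list) \<Rightarrow> bool" where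
  "good_forests n k F \<longleftrightarrow>
    (\<forall>\<sigma><2 ^ (2 * k + 3). F \<sigma> \<in> forests 8 (trees n (slots k) (samples k) (k + 1))) \<and>
    (\<forall>E s t. E \<subseteq> {..<n} \<times> {..<n} \<longrightarrow> (\<forall>v<n. (v, v) \<in> E) \<longrightarrow> s < n \<longrightarrow> t < n \<longrightarrow> (s, t) \<in> E\<^sup>* \<longrightarrow>
       3 * card {\<sigma>. \<sigma> < 2 ^ (2 * k + 3) \<and> miss (slots k) E s t (F \<sigma>)} \<le> 2 ^ (2 * k + 3))"

definition the_forests :: "nat \<Rightarrow> nat \<Rightarrow> tree list" where
  "the_forests n = (SOME F. good_forests n (ceillog2 n) F)"

definition the_alg :: "nat \<Rightarrow> qalg" where
  "the_alg n = (let k = ceillog2 n in machine.alg k (slots k) (k + 1) 8 (2 * k + 3) (the_forests n))"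

lemma the_forests_good: "1 \<le> n \<Longrightarrow> good_forests n (ceillog2 n) (the_forests n)"
  unfolding the_forests_def
proof (rule someI_ex[of "good_forests n (ceillog2 n)"])
  assume n: "1 \<le> n"
  have "0 < slots (ceillog2 n)" by (simp add: slots_def)
  from sampling.good_seeds[OF sampling_params[OF n le_two_power_ceillog2] order_refl
      range_len_params[OF le_two_power_ceillog2] this le_two_power_ceillog2]
  show "\<exists>F. good_forests n (ceillog2 n) F" unfolding good_forests_def .
qed

lemma the_machine:
  assumes "1 \<le> n"
  shows "machine n (ceillog2 n) (slots (ceillog2 n)) (ceillog2 n + 1) 8 (2 * ceillog2 n + 3)
    (samples (ceillog2 n)) (the_forests n)"
  by unfold_locales
    (use the_forests_good[OF assms] in \<open>auto simp: good_forests_def slots_def le_two_power_ceillog2\<close>)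

lemma the_alg_decides:
  assumes n: "1 \<le> n" and G: "pair_fin_digraph G" "pverts G = {..<n}" "\<forall>u\<in>pverts G. (u, u) \<in> parcs G"
  shows "decides_dstcon n (the_alg n) G"
  unfolding decides_dstcon_def
proof (intro ballI)
  fix s t assume st: "s \<in> pverts G" "t \<in> pverts G"
  define k where "k = ceillog2 n"
  define M where "M = (2::nat) ^ (2 * k + 3)"
  interpret machine n k "slots k" "k + 1" 8 "2 * k + 3" "samples k" "the_forests n"
    unfolding k_def by (rule the_machine[OF n])
  have less: "s < n" "t < n" "s < 2 ^ k" "t < 2 ^ k"
    using st G(2) le_two_power_ceillog2[of n] unfolding k_def by auto
  have E: "parcs G \<subseteq> {..<n} \<times> {..<n}" "\<forall>v<n. (v, v) \<in> parcs G"
  proof -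
    interpret pair_fin_digraph G by (rule G)
    show "parcs G \<subseteq> {..<n} \<times> {..<n}" using in_arcsD1 in_arcsD2 G(2) by force
  qed (use G in auto)
  let ?miss = "\<lambda>\<sigma>. miss (slots k) (parcs G) s t (the_forests n \<sigma>)"
  have p: "prob_output n (the_alg n) G s t b = card {\<sigma>. \<sigma> < M \<and> (\<not> ?miss \<sigma>) = b} / M" for b
    using prob_output_alg[OF k_def less(3,4), of G b] by (simp add: the_alg_def Let_def k_def[symmetric] M_def)
  have M: "0 < M" by (simp add: M_def)
  show "2 / 3 \<le> prob_output n (the_alg n) G s t (dstcon G s t)"
  proof (cases "(s, t) \<in> (parcs G)\<^sup>*")
    case True
    have "3 * card {\<sigma>. \<sigma> < M \<and> ?miss \<sigma>} \<le> M"
      using the_forests_good[OF n] E less True unfolding good_forests_def k_def[symmetric] M_def by blast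
    moreover have "card {\<sigma>. \<sigma> < M \<and> ?miss \<sigma>} + card {\<sigma>. \<sigma> < M \<and> \<not> ?miss \<sigma>} = M"
    proof -
      have "card {..<M} = card ({\<sigma>. \<sigma> < M \<and> ?miss \<sigma>} \<union> {\<sigma>. \<sigma> < M \<and> \<not> ?miss \<sigma>})"
        by (rule arg_cong[of _ _ card]) auto
      also have "\<dots> = card {\<sigma>. \<sigma> < M \<and> ?miss \<sigma>} + card {\<sigma>. \<sigma> < M \<and> \<not> ?miss \<sigma>}"
        by (rule card_Un_disjoint) auto
      finally show ?thesis by simp
    qed
    ultimately have "2 * M \<le> 3 * card {\<sigma>. \<sigma> < M \<and> \<not> ?miss \<sigma>}" by linarith
    then have "2 * real M \<le> 3 * real (card {\<sigma>. \<sigma> < M \<and> \<not> ?miss \<sigma>})"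
      using of_nat_mono[where 'a = real] by fastforce
    moreover have "dstcon G s t" using True dstcon_iff[OF G(1) st(1)] by simp
    ultimately show ?thesis using M by (simp add: p field_simps)
  next
    case False
    have "{\<sigma>. \<sigma> < M \<and> ?miss \<sigma>} = {..<M}" using miss_sound[OF False] by auto
    moreover have "\<not> dstcon G s t" using False dstcon_iff[OF G(1) st(1)] by simp
    ultimately show ?thesis using M by (simp add: p)
  qed
qed

lemma ops_len_le:
  "ops_len S (samples k) j \<le> S * S * 2 ^ (7 * j + (\<Sum>i<j. k - i - 16))"
proof (induction j)
  case (Suc j)
  \<comment> \<open>\<open>samples\<close> is 32 times a power of two, and 3 * 32 + 1 = 97 is at
    most 2^7.\<close>
  have "3 * samples k j + 1 \<le> 2 ^ (7 + (k - j - 16))"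
    using one_le_power[of "2::nat" "k - j - 16"] by (simp add: samples_def power_add)
  then have "ops_len S (samples k) (Suc j) \<le>
      2 ^ (7 + (k - j - 16)) * (S * S * 2 ^ (7 * j + (\<Sum>i<j. k - i - 16)))"
    unfolding ops_len.simps using Suc by (rule mult_mono) simp_all
  then show ?case by (simp add: power_add ac_simps)
qed simp

text \<open>Read backwards, the sum is 1 + 2 + ... + (k - 16); truncation makes the formula hold
  below 16 as well.\<close>

lemma sum_exponents: "2 * (\<Sum>i<k + 1. k - i - 16) = (k - 16) * (k - 15)" for k :: nat
proof -
  have "(\<Sum>i<k + 1. k - i - 16) = (\<Sum>i<k + 1. (k + 1 - Suc i) - 16)" by simp
  also have "\<dots> = (\<Sum>i<k + 1. i - 16)" by (rule sum.nat_diff_reindex)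
  also have "2 * (\<Sum>i<k + 1. i - 16) = (k - 16) * (k - 15)"
  proof (induction k)
    case (Suc k)
    have "(\<Sum>i<Suc k + 1. i - 16) = (\<Sum>i<k + 1. i - 16) + (k + 1 - 16)" by simp
    then have eq: "2 * (\<Sum>i<Suc k + 1. i - 16) = (k - 16) * (k - 15) + 2 * (k + 1 - 16)"
      using Suc by linarith
    show ?case
    proof (cases "k < 16")
      case True
      then show ?thesis unfolding eq by (cases "k = 15") auto
    next
      case False
      then obtain d where "k = 16 + d" using le_Suc_ex not_less by blast
      then show ?thesis unfolding eq by (simp add: algebra_simps)
    qed
  qed simp
  finally show ?thesis .
qed

text \<open>In the exponent, 34 and a factor (k + 1)^2 come from the pairs of slots in a leaf, 7 (k
  + 1) from the constant factor of each level, and 6 from the remaining constants. One more factor k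
  + 1 is the cost of a block, and (k + 1)^3 <= 2^(3 k).\<close>

lemma qtime_the_alg:
  assumes "1 \<le> n" "k = ceillog2 n"
  shows "qtime (the_alg n) \<le> 2 ^ (47 + 10 * k + (\<Sum>i<k + 1. k - i - 16))"
proof -
  interpret machine n k "slots k" "k + 1" 8 "2 * k + 3" "samples k" "the_forests n"
    unfolding assms(2) by (rule the_machine[OF assms(1)])
  define e where "e = 7 * (k + 1) + (\<Sum>i<k + 1. k - i - 16)"
  have k: "k + 1 \<le> 2 ^ k" by (metis Suc_eq_plus1 Suc_leI less_exp)
  have "qtime (the_alg n) = 2 * k + 3 + 8 * ops_len (slots k) (samples k) (k + 1) * (4 * k + 3) + 2"
    using qtime_alg by (simp add: the_alg_def Let_def assms(2)[symmetric])
  also have "\<dots> \<le> 5 * (k + 1) + 8 * (slots k * slots k * 2 ^ e) * (4 * (k + 1))"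
  proof -
    have "ops_len (slots k) (samples k) (k + 1) \<le> slots k * slots k * 2 ^ e"
      unfolding e_def by (rule ops_len_le)
    then have "8 * ops_len (slots k) (samples k) (k + 1) * (4 * k + 3) \<le>
        8 * (slots k * slots k * 2 ^ e) * (4 * (k + 1))"
      by (intro mult_mono) simp_all
    moreover have "2 * k + 3 + a + 2 \<le> 5 * (k + 1) + b" if "a \<le> b" for a b :: nat
      using that by simp
    ultimately show ?thesis by blast
  qed
  also have "\<dots> \<le> 2 ^ 34 * 2 ^ e * (k + 1) ^ 3 * 64"
  proof -
    have "1 * 1 \<le> (2::nat) ^ e * (k + 1) ^ 2" by (intro mult_mono) auto
    then have "(k + 1) * 1 \<le> (k + 1) * (2 ^ e * (k + 1) ^ 2)" by (intro mult_left_mono) auto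
    then have "k + 1 \<le> 2 ^ e * (k + 1) ^ 3"
      by (simp only: power2_eq_square power3_eq_cube mult_1_left mult_1_right ac_simps)
    then have x: "5 * (k + 1) \<le> 5 * (2 ^ e * (k + 1) ^ 3)" by (rule mult_left_mono) simp
    have "8 * ((2 ^ 17 * c) * (2 ^ 17 * c) * a) * (4 * c) = 2 ^ 34 * 32 * (a * c ^ 3)" for a c :: nat
      by (simp add: power3_eq_cube)
    then have p: "8 * (slots k * slots k * 2 ^ e) * (4 * (k + 1)) = 2 ^ 34 * 32 * (2 ^ e * (k + 1) ^ 3)"
      unfolding slots_def .
    have q: "2 ^ 34 * 2 ^ e * (k + 1) ^ 3 * 64 = 2 ^ 34 * 64 * (2 ^ e * (k + 1) ^ 3)"
      by (simp only: ac_simps)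
    have "a + 2 ^ 34 * 32 * b \<le> 2 ^ 34 * 64 * b" if "a \<le> 5 * b" for a b :: nat
      using that by simp
    with x show ?thesis unfolding p q by blast
  qed
  also have "\<dots> \<le> 2 ^ 34 * 2 ^ e * (2 ^ k) ^ 3 * 2 ^ 6"
    using power_mono[OF k, of 3] by (intro mult_mono) auto
  also have "\<dots> = 2 ^ (34 + e + k * 3 + 6)" by (simp only: power_add power_mult)
  also have "34 + e + k * 3 + 6 = 47 + 10 * k + (\<Sum>i<k + 1. k - i - 16)" by (simp add: e_def)
  finally show ?thesis .
qed

text \<open>Rounding gives k <= L + 1 and a main term of at most (L - 15) (L - 14) / 2, which is
  29/2 L - 105 below L^2 / 2. Against the 10 L + 57 from the other factors, 9/2 L - 162 is left,
  which is nonnegative from L = 36 on.\<close>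

lemma qtime_the_alg_powr:
  assumes L: "36 \<le> log 2 (real n)"
  shows "real (qtime (the_alg n)) \<le> 2 powr (1 / 2 * (log 2 (real n))\<^sup>2)"
proof -
  define L where "L = log 2 (real n)"
  define k where "k = ceillog2 n"
  define \<Sigma> where "\<Sigma> = (\<Sum>i<k + 1. k - i - 16)"
  have n: "1 \<le> n" using L by (cases "n = 0") (auto simp: log_def)
  have k: "L \<le> k" "k \<le> L + 1"
    using ceillog2_ge_log[of n] ceillog2_less_log[of n] n by (auto simp: L_def k_def)
  have "2 * real \<Sigma> = real ((k - 16) * (k - 15))"
    using arg_cong[OF sum_exponents[of k], of real] by (simp add: \<Sigma>_def)
  also have "\<dots> = (real k - 16) * (real k - 15)"
    using k L by (simp add: L_def of_nat_diff)
  also have "\<dots> \<le> (L - 15) * (L - 14)"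
    using k L by (intro mult_mono) (auto simp: L_def)
  finally have "real (47 + 10 * k + \<Sigma>) \<le> 47 + 10 * (L + 1) + (L - 15) * (L - 14) / 2"
    using k by simp
  also have "\<dots> = 1 / 2 * L\<^sup>2 - (9 / 2 * L - 162)"
    by (simp add: power2_eq_square field_simps)
  also have "\<dots> \<le> 1 / 2 * L\<^sup>2" using L by (simp add: L_def)
  finally have e: "real (47 + 10 * k + \<Sigma>) \<le> 1 / 2 * L\<^sup>2" .
  have "real (qtime (the_alg n)) \<le> real (2 ^ (47 + 10 * k + \<Sigma>))"
    unfolding \<Sigma>_def by (intro of_nat_mono qtime_the_alg n k_def)
  also have "\<dots> = 2 powr real (47 + 10 * k + \<Sigma>)" by (subst powr_realpow) simp_all
  also have "\<dots> \<le> 2 powr (1 / 2 * L\<^sup>2)" using e by (rule powr_mono) simp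
  finally show ?thesis by (simp only: L_def)
qed

lemma eventually_log_ge: "\<forall>\<^sub>F n in sequentially. c \<le> log 2 (real n)"
proof -
  have "\<forall>\<^sub>F n in sequentially. 2 powr c \<le> real n"
    by (rule eventually_sequentiallyI[of "nat \<lceil>2 powr c\<rceil>"]) linarith
  then show ?thesis
  proof eventually_elim
    case (elim n)
    then have "0 < real n" using powr_gt_zero[of 2 c] by linarith
    then show ?case using elim by (simp add: le_log_iff)
  qed
qed

lemma qubits_the_alg:
  assumes L: "1 \<le> log 2 (real n)"
  shows "real (qubits (the_alg n)) \<le> 2 ^ 24 * (log 2 (real n))\<^sup>2"
proof -
  define L where "L = log 2 (real n)"
  define k where "k = ceillog2 n"
  have n: "1 \<le> n" using L by (cases "n = 0") (auto simp: log_def)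
  interpret machine n k "slots k" "k + 1" 8 "2 * k + 3" "samples k" "the_forests n"
    unfolding k_def by (rule the_machine[OF n])
  have k: "L \<le> k" "k \<le> L + 1"
    using ceillog2_ge_log[of n] ceillog2_less_log[of n] n by (auto simp: L_def k_def)
  have k1: "1 \<le> k" using k L by (simp add: L_def)
  have "qubits (the_alg n) = 6 * k + 5 + (k + 10) * (2 ^ 17 * (k + 1))"
    unfolding the_alg_def Let_def k_def[symmetric] alg_def width_def base_def sd_def
    by (simp add: slots_def)
  also have "\<dots> \<le> 11 * (k * k) + (11 * k) * (2 ^ 17 * (2 * k))"
  proof (intro add_mono mult_mono)
    have "k \<le> k * k" using k1 by simp
    then show "6 * k + 5 \<le> 11 * (k * k)" using k1 by linarith
  qed (use k1 in auto)
  also have "\<dots> \<le> 2 ^ 22 * (k * k)" by simp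
  finally have "real (qubits (the_alg n)) \<le> 2 ^ 22 * (real k * real k)"
    using of_nat_mono[where 'a = real] by fastforce
  also have "\<dots> \<le> 2 ^ 22 * ((2 * L) * (2 * L))"
    using k L by (intro mult_left_mono mult_mono) (auto simp: L_def)
  finally show ?thesis by (simp add: L_def power2_eq_square)
qed

theorem theorem5p3:
  shows "\<exists>A :: nat \<Rightarrow> qalg.
    (\<forall>n\<ge>1. st_algorithm n (A n) \<and>
      (\<forall>G :: nat pair_pre_digraph.
         pair_fin_digraph G \<and> pverts G = {..<n} \<and> (\<forall>u \<in> pverts G. (u, u) \<in> parcs G) \<longrightarrow>
         decides_dstcon n (A n) G)) \<and>
    (\<lambda>n. real (qtime (A n))) \<in> soft_O (\<lambda>n. sqrt (2 * real n) powr log 2 (real n)) \<and>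
    (\<exists>h :: nat \<Rightarrow> real. h \<in> O(\<lambda>n. log 2 (real n)) \<and>
      (\<forall>\<^sub>F n in sequentially.
         real (qtime (A n)) \<le> 2 powr (1 / 2 * (log 2 (real n))\<^sup>2 + h n))) \<and>
    (\<lambda>n. real (qubits (A n))) \<in> O(\<lambda>n. (log 2 (real n))\<^sup>2)"
proof (intro exI[of _ the_alg] conjI allI impI)
  fix n :: nat assume n: "1 \<le> n"
  show "st_algorithm n (the_alg n)"
    using machine.st_algorithm_alg[OF the_machine[OF n] refl] by (simp add: the_alg_def Let_def)
  show "decides_dstcon n (the_alg n) G"
    if "pair_fin_digraph G \<and> pverts G = {..<n} \<and> (\<forall>u \<in> pverts G. (u, u) \<in> parcs G)" for G
    using the_alg_decides[OF n] that by blast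
next
  have time: "\<forall>\<^sub>F n in sequentially. real (qtime (the_alg n)) \<le> 2 powr (1 / 2 * (log 2 (real n))\<^sup>2)"
    using eventually_log_ge[of 36] by eventually_elim (rule qtime_the_alg_powr)
  have "(\<lambda>n. real (qtime (the_alg n))) \<in> O(\<lambda>n. sqrt (2 * real n) powr log 2 (real n))"
  proof (rule bigoI[of _ 1])
    show "\<forall>\<^sub>F n in sequentially.
        norm (real (qtime (the_alg n))) \<le> 1 * norm (sqrt (2 * real n) powr log 2 (real n))"
      using time eventually_log_ge[of 1]
    proof eventually_elim
      case (elim n)
      define L where "L = log 2 (real n)"
      have n: "0 < real n" using elim(2) by (cases "n = 0") (auto simp: log_def)
      \<comment> \<open>The target bound exceeds 2 powr (L^2 / 2) by the factor 2 powr (L / 2), so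
        the time bound already obtained suffices.\<close>
      have "sqrt (2 * real n) = 2 powr ((1 + L) / 2)"
      proof -
        have "2 * real n = 2 powr (1 + L)" using n by (simp add: L_def powr_add)
        then have "sqrt (2 * real n) = (2 powr (1 + L)) powr (1 / 2)" by (simp add: powr_half_sqrt)
        then show ?thesis by (simp add: powr_powr)
      qed
      then have g: "sqrt (2 * real n) powr L = 2 powr ((1 + L) / 2 * L)" by (simp add: powr_powr)
      have "1 / 2 * L\<^sup>2 \<le> (1 + L) / 2 * L"
        using elim(2) by (simp add: L_def power2_eq_square field_simps)
      then have "2 powr (1 / 2 * L\<^sup>2) \<le> sqrt (2 * real n) powr L" unfolding g by (rule powr_mono) simp
      then have "real (qtime (the_alg n)) \<le> sqrt (2 * real n) powr L"
        using elim(1) unfolding L_def by (rule order_trans[rotated])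
      then show ?case by (simp add: L_def)
    qed
  qed
  then show "(\<lambda>n. real (qtime (the_alg n))) \<in> soft_O (\<lambda>n. sqrt (2 * real n) powr log 2 (real n))"
    \<comment> \<open>No logarithmic factor is left over, hence the exponent 0.\<close>
    unfolding soft_O_def by (intro CollectI exI[of _ 0]) simp
  show "\<exists>h :: nat \<Rightarrow> real. h \<in> O(\<lambda>n. log 2 (real n)) \<and>
      (\<forall>\<^sub>F n in sequentially.
         real (qtime (the_alg n)) \<le> 2 powr (1 / 2 * (log 2 (real n))\<^sup>2 + h n))"
    \<comment> \<open>The savings per level already absorb all lower-order terms, so the correction
      is 0.\<close>
    using time by (intro exI[of _ "\<lambda>_. 0"]) simp
  show "(\<lambda>n. real (qubits (the_alg n))) \<in> O(\<lambda>n. (log 2 (real n))\<^sup>2)"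
  proof (rule bigoI[of _ "2 ^ 24"])
    show "\<forall>\<^sub>F n in sequentially.
        norm (real (qubits (the_alg n))) \<le> 2 ^ 24 * norm ((log 2 (real n))\<^sup>2)"
      using eventually_log_ge[of 1]
      by eventually_elim (use qubits_the_alg in simp)
  qed
qed

end
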